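(* Let $G=\mathrm{GIRG}(n,\beta,w_0,d)$ be a standard GIRG with $\beta<3$ and $d=\omega(\log n)$. Then $\mathbb{E}[K_k]=n^{\frac k2(3-\beta)}\Theta(k)^{-k}$ for $k\ge3$, and $\omega(G)=\Theta(n^{(3-\beta)/2})$ asymptotically almost surely.
   Context: Fix constants $\lambda>0$, $w_0>0$, $\beta>2$. A standard GIRG $\mathrm{GIRG}(n,\beta,w_0,d)$ has $n$ vertices; each vertex $v$ independently receives a weight $w_v$ with $\Pr[w_v\le x]=1-(x/w_0)^{1-\beta}$ for $x\ge w_0$, and independently a position $\mathbf{x}_v$ uniform on the torus $\mathbb{T}^d=[0,1)^d$. The distance is $d(\mathbf{x}_u,\mathbf{x}_v)=\max_{1\le i\le d}|x_{ui}-x_{vi}|_C$ with $|a-b|_C=\min\{|a-b|,1-|a-b|\}$. Distinct $u,v$ are adjacent iff $d(\mathbf{x}_u,\mathbf{x}_v)\le \frac12\big(\frac{\lambda w_uw_v}{n}\big)^{1/d}$. The dimension $d=d(n)$ depends on $n$; asymptotics are as $n\to\infty$. $K_k$ is the number of $k$-cliques, $\omega(G)$ the clique number; $\Theta(k)^{-k}$ denotes a quantity between $(c_1k)^{-k}$ and $(c_2k)^{-k}$ for positive constants $c_1,c_2$ independent of $n,k$; "asymptotically almost surely" means with probability $1-o(1)$.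
   Formalization: The lower bound on E[K_k] is stated for 3 ≤ k ≤ n only, since K_k = 0 for k > n while n^{k(3-β)/2}Θ(k)^{-k} is positive; the upper bound holds for all k ≥ 3, and both hold for all sufficiently large n, uniformly in k. *)

theory Defs
  imports "HOL-Probability.Probability" "HOL-Library.Landau_Symbols"
begin

definition weight_cdf :: "real \<Rightarrow> real \<Rightarrow> real \<Rightarrow> real" where
  "weight_cdf \<beta> w0 x = (if x < w0 then 0 else 1 - (x / w0) powr (1 - \<beta>))"

definition weight_measure :: "real \<Rightarrow> real \<Rightarrow> real measure" where
  "weight_measure \<beta> w0 = interval_measure (weight_cdf \<beta> w0)"

definition torus_measure :: "nat \<Rightarrow> (nat \<Rightarrow> real) measure" where
  "torus_measure d = (\<Pi>\<^sub>M i\<in>{..<d}. uniform_measure lborel {0..<1})"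

text \<open>An outcome \<open>G\<close> assigns to each vertex \<open>v < n\<close> the pair of its weight and its position.\<close>

type_synonym girg_outcome = "nat \<Rightarrow> real \<times> (nat \<Rightarrow> real)"

definition girg_measure :: "nat \<Rightarrow> real \<Rightarrow> real \<Rightarrow> nat \<Rightarrow> girg_outcome measure" where
  "girg_measure n \<beta> w0 d = (\<Pi>\<^sub>M v\<in>{..<n}. weight_measure \<beta> w0 \<Otimes>\<^sub>M torus_measure d)"

definition circle_dist :: "real \<Rightarrow> real \<Rightarrow> real" where
  "circle_dist a b = min \<bar>a - b\<bar> (1 - \<bar>a - b\<bar>)"

text \<open>Only meaningful for \<open>d \<ge> 1\<close>; the maximum over the empty set is unspecified.\<close>

definition torus_dist :: "nat \<Rightarrow> (nat \<Rightarrow> real) \<Rightarrow> (nat \<Rightarrow> real) \<Rightarrow> real" where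
  "torus_dist d x y = Max ((\<lambda>i. circle_dist (x i) (y i)) ` {..<d})"

definition girg_adj :: "real \<Rightarrow> nat \<Rightarrow> nat \<Rightarrow> girg_outcome \<Rightarrow> nat \<Rightarrow> nat \<Rightarrow> bool" where
  "girg_adj lam n d G u v \<longleftrightarrow> u \<noteq> v \<and>
     torus_dist d (snd (G u)) (snd (G v))
       \<le> 1 / 2 * (lam * fst (G u) * fst (G v) / real n) powr (1 / real d)"

definition cliques :: "'v set \<Rightarrow> ('v \<Rightarrow> 'v \<Rightarrow> bool) \<Rightarrow> 'v set set" where
  "cliques V adj = {S. S \<subseteq> V \<and> pairwise adj S}"

definition num_cliques :: "'v set \<Rightarrow> ('v \<Rightarrow> 'v \<Rightarrow> bool) \<Rightarrow> nat \<Rightarrow> nat" where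
  "num_cliques V adj k = card {S \<in> cliques V adj. card S = k}"

definition clique_number :: "'v set \<Rightarrow> ('v \<Rightarrow> 'v \<Rightarrow> bool) \<Rightarrow> nat" where
  "clique_number V adj = Max (card ` cliques V adj)"

definition girg_num_cliques :: "real \<Rightarrow> nat \<Rightarrow> nat \<Rightarrow> nat \<Rightarrow> girg_outcome \<Rightarrow> nat" where
  "girg_num_cliques lam n d k G = num_cliques {..<n} (girg_adj lam n d G) k"

definition girg_clique_number :: "real \<Rightarrow> nat \<Rightarrow> nat \<Rightarrow> girg_outcome \<Rightarrow> nat" where
  "girg_clique_number lam n d G = clique_number {..<n} (girg_adj lam n d G)"


lemma weight_cdf_properties:
  assumes "w0 > 0" "\<beta> > 1"
  shows "x \<le> y \<Longrightarrow> weight_cdf \<beta> w0 x \<le> weight_cdf \<beta> w0 y"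
    and "continuous (at_right a) (weight_cdf \<beta> w0)"
    and "(weight_cdf \<beta> w0 \<longlongrightarrow> 0) at_bot"
    and "(weight_cdf \<beta> w0 \<longlongrightarrow> 1) at_top"
proof -
  have eq: "weight_cdf \<beta> w0 = (\<lambda>x. 1 - (max x w0 / w0) powr (1 - \<beta>))"
    using assms by (auto simp: weight_cdf_def fun_eq_iff max_def)
  show "x \<le> y \<Longrightarrow> weight_cdf \<beta> w0 x \<le> weight_cdf \<beta> w0 y"
    unfolding eq using assms
    by (auto intro!: powr_mono2' divide_right_mono simp: less_max_iff_disj max.coboundedI1)
  have "continuous_on UNIV (weight_cdf \<beta> w0)"
    unfolding eq using assms by (intro continuous_intros) (auto simp: max_def)
  then show "continuous (at_right a) (weight_cdf \<beta> w0)"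
    by (metis UNIV_I continuous_at_imp_continuous_at_within continuous_on_eq_continuous_at open_UNIV)
  show "(weight_cdf \<beta> w0 \<longlongrightarrow> 0) at_bot"
    by (rule tendsto_eventually, rule eventually_mono[OF eventually_gt_at_bot[of w0]])
       (simp add: weight_cdf_def)
  have "filterlim (\<lambda>x. inverse w0 * x) at_top at_top"
    using assms
    by (intro filterlim_tendsto_pos_mult_at_top[OF tendsto_const] filterlim_ident) auto
  then have "filterlim (\<lambda>x. x / w0) at_top at_top"
    by (simp add: field_simps)
  then have "((\<lambda>x. (x / w0) powr (1 - \<beta>)) \<longlongrightarrow> 0) at_top"
    using assms by (intro tendsto_neg_powr) auto
  from tendsto_diff[OF tendsto_const this, of 1]
  have "((\<lambda>x. 1 - (x / w0) powr (1 - \<beta>)) \<longlongrightarrow> 1) at_top"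
    by simp
  then show "(weight_cdf \<beta> w0 \<longlongrightarrow> 1) at_top"
    by (rule Lim_transform_eventually)
       (use eventually_ge_at_top[of w0] in eventually_elim, simp add: weight_cdf_def)
qed

lemma prob_space_weight_measure:
  assumes "w0 > 0" "\<beta> > 1"
  shows "prob_space (weight_measure \<beta> w0)"
  using real_distribution_interval_measure[OF weight_cdf_properties[OF assms]]
  by (simp add: weight_measure_def real_distribution_def)

lemma measure_weight_measure_Iic:
  assumes "w0 > 0" "\<beta> > 1" "x \<ge> w0"
  shows "measure (weight_measure \<beta> w0) {..x} = 1 - (x / w0) powr (1 - \<beta>)"
  using measure_interval_measure_Iic[OF weight_cdf_properties(1-3)[OF assms(1,2)], of x] assms(3)
  by (simp add: weight_measure_def weight_cdf_def)

lemma prob_space_torus_measure: "prob_space (torus_measure d)"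
  unfolding torus_measure_def
  by (intro prob_space_PiM prob_space_uniform_measure) auto

lemma prob_space_girg_measure:
  assumes "w0 > 0" "\<beta> > 1"
  shows "prob_space (girg_measure n \<beta> w0 d)"
proof -
  interpret W: prob_space "weight_measure \<beta> w0"
    by (rule prob_space_weight_measure[OF assms])
  interpret T: prob_space "torus_measure d"
    by (rule prob_space_torus_measure)
  interpret pair_prob_space "weight_measure \<beta> w0" "torus_measure d" ..
  show ?thesis
    unfolding girg_measure_def by (intro prob_space_PiM) unfold_locales
qed

end

theory Submission
  imports Defs
begin

text \<open>
  Put \<open>x\<^sub>v = w\<^sub>v sqrt (lam / n)\<close>, so that \<open>u\<close> and \<open>v\<close> are adjacent with conditional probability
  \<open>p\<^sub>u\<^sub>v = min 1 (x\<^sub>u x\<^sub>v)\<close>. In each coordinate an edge fails with probability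
  \<open>1 - p\<^sub>u\<^sub>v powr (1 / d)\<close>, which tends to \<open>0\<close> uniformly because \<open>d\<close> grows faster than \<open>ln n\<close>, and
  the failures of two different edges are independent. Bonferroni's inequality therefore shows that
  a set of at most five vertices is a clique with conditional probability at most the product of
  \<open>p\<^sub>u\<^sub>v powr \<gamma>\<close>, where \<open>\<gamma> < 1\<close> is as close to \<open>1\<close> as desired. For at least three vertices this
  product is bounded by a product of one-vertex factors \<open>f x\<^sub>v\<close> whose expectation has the order
  \<open>n powr (- (\<beta> - 1) / 2)\<close> of the probability that \<open>x\<^sub>v > 1\<close>. Splitting \<open>k\<close> vertices into
  independent groups of three, four or five gives the upper bound on the expected number of cliques,
  and hence on the clique number. Both lower bounds come from the vertices with \<open>x\<^sub>v > 1\<close>, which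
  always form a clique.
\<close>

section \<open>One coordinate of the torus\<close>

text \<open>The three edges of a triangle are not independent: if \<open>u\<close> is close to
  \<open>v\<close> and to \<open>w\<close>, then \<open>v\<close> and \<open>w\<close> are likelier
  to be close. In one coordinate this correlation is of second order in the failure probabilities,
  so taking the \<open>d\<close>-th power costs only the passage from exponent 1 to \<gamma>. The
  loss stays small only while the number of edges times the failure probability is small, hence the
  groups of bounded size. Discarding the edges between groups is harmless, because the target has
  one factor per vertex and a group of three already attains it. A group of two does not: the
  expectation of \<open>min 1 (x_u * x_v)\<close> has order 1 / n, coming from light vertices, which
  exceeds n to the power 1 - \<beta>.

  Nor may the loss in \<gamma> change the order in n. The factor \<open>f\<close> has exponent
  \<open>\<gamma> * (1 + s)\<close> near 0 and \<open>2 * s\<close> at infinity, while the weight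
  tail has exponent \<open>\<beta> - 1\<close>. The mean of \<open>f\<close> is dominated by
  arguments of order 1 when \<open>2 * s < \<beta> - 1 < \<gamma> * (1 + s)\<close>. For \<gamma> =
  1 this asks for s strictly between \<beta> - 2 and (\<beta> - 1) / 2, which is possible since
  \<beta> < 3; strictness leaves room for \<gamma> < 1.\<close>

abbreviation unif :: "real measure" where
  "unif \<equiv> uniform_measure lborel {0..<1}"

lemma prob_space_unif: "prob_space unif"
  by (intro prob_space_uniform_measure) auto

lemma circle_dist_le_half: "circle_dist a b \<le> 1 / 2"
  by (auto simp: circle_dist_def min_def)

lemma circle_dist_commute: "circle_dist a b = circle_dist b a"
  by (simp add: circle_dist_def abs_minus_commute)

lemma measurable_circle_dist [measurable (raw)]:
  assumes "f \<in> borel_measurable M" "g \<in> borel_measurable M"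
  shows "(\<lambda>x. circle_dist (f x) (g x)) \<in> borel_measurable M"
  using assms unfolding circle_dist_def by measurable

text \<open>The far points form an arc of length \<open>1 - q\<close> wherever \<open>a\<close>
  lies; this rotation invariance is the source of the independence of edges. The cases ask whether
  the ball around \<open>a\<close> crosses the point 0: if so, the far arc is a single interval of
  \<open>{0..<1}\<close>, otherwise it is cut in two.\<close>

lemma emeasure_unif_circle_dist:
  fixes a q :: real
  assumes "0 \<le> a" "a < 1" "0 \<le> q" "q \<le> 1"
  shows "emeasure unif {b. q / 2 < circle_dist a b} = ennreal (1 - q)"
proof -
  let ?S = "{b. q / 2 < circle_dist a b}"
  have S: "?S \<in> sets lborel"
    by measurable
  have "emeasure unif ?S = emeasure lborel ({0..<1} \<inter> ?S) / emeasure lborel {0..<1::real}"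
    using S by (intro emeasure_uniform_measure) auto
  then have *: "emeasure unif ?S = emeasure lborel ({0..<1} \<inter> ?S)"
    by (simp add: divide_ennreal_def)
  consider "a < q / 2" | "q / 2 \<le> a" "a < 1 - q / 2" | "1 - q / 2 \<le> a"
    by linarith
  then have "emeasure lborel ({0..<1} \<inter> ?S) = ennreal (1 - q)"
  proof cases
    case 1
    then have "{0..<1} \<inter> ?S = {a + q / 2 <..< a + 1 - q / 2}"
      using assms by (auto simp: circle_dist_def min_def abs_if split: if_splits)
    then show ?thesis using assms by (simp add: algebra_simps)
  next
    case 2
    then have eq: "{0..<1} \<inter> ?S = {a + q / 2 <..< 1} \<union> {0..< a - q / 2}"
      using assms by (auto simp: circle_dist_def min_def abs_if split: if_splits)
    have "emeasure lborel ({a + q / 2 <..< 1} \<union> {0..< a - q / 2}) =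
        emeasure lborel {a + q / 2 <..< 1} + emeasure lborel {0..< a - q / 2}"
      using assms by (intro plus_emeasure[symmetric]) auto
    also have "\<dots> = ennreal (1 - q)"
      using 2 assms by (simp flip: ennreal_plus)
    finally show ?thesis unfolding eq .
  next
    case 3
    then have "{0..<1} \<inter> ?S = {a - 1 + q / 2 <..< a - q / 2}"
      using assms by (auto simp: circle_dist_def min_def abs_if split: if_splits)
    then show ?thesis using assms by (simp add: algebra_simps)
  qed
  with * show ?thesis by simp
qed

lemma AE_PiM_unif:
  assumes "finite V" "v \<in> V"
  shows "AE x in (\<Pi>\<^sub>M v\<in>V. unif). x v \<in> {0..<1}"
proof -
  have "AE y in unif. y \<in> {0..<1}"
    by (intro AE_uniform_measureI) auto
  then show ?thesis
    by (intro AE_PiM_component) (use assms prob_space_unif in auto)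
qed

text \<open>Condition on all positions except that of \<open>u\<close>. Then \<open>B\<close> is
  decided, and the uniform position of \<open>u\<close> is far from the fixed position of
  \<open>v\<close> with probability \<open>1 - q\<close>. Invariance under overwriting entry
  \<open>u\<close> expresses that \<open>B\<close> does not depend on it.\<close>

lemma prob_far_Int:
  fixes V :: "nat set" and q :: real
  assumes "finite V" "u \<in> V" "v \<in> V" "u \<noteq> v" "0 \<le> q" "q \<le> 1"
    and B: "B \<in> sets (\<Pi>\<^sub>M v\<in>V. unif)"
    and B_indep: "\<And>x y. x \<in> B \<longleftrightarrow> x(u := y) \<in> B"
  shows "measure (\<Pi>\<^sub>M v\<in>V. unif) (B \<inter> {x. q / 2 < circle_dist (x v) (x u)})
    = measure (\<Pi>\<^sub>M v\<in>V. unif) B * (1 - q)"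
proof -
  let ?P = "\<lambda>V :: nat set. \<Pi>\<^sub>M v\<in>V. unif"
  define V' where "V' = V - {u}"
  have V: "V = insert u V'" "u \<notin> V'" "finite V'" "v \<in> V'"
    using assms by (auto simp: V'_def)
  interpret U: prob_space unif by (rule prob_space_unif)
  interpret product_prob_space "\<lambda>_::nat. unif" V by unfold_locales
  let ?F = "{x \<in> space (?P V). q / 2 < circle_dist (x v) (x u)}"
  have F [measurable]: "?F \<in> sets (?P V)"
    using assms by measurable
  have BF: "indicator (B \<inter> ?F) \<in> borel_measurable (?P V)"
    using B F by (intro borel_measurable_indicator sets.Int)
  have upd: "(\<lambda>x. x(u := y)) \<in> measurable (?P V') (?P V)" for y
    by (rule measurable_fun_upd[where J = V']) (use V in auto)
  have "emeasure (?P V) (B \<inter> ?F) = (\<integral>\<^sup>+x. indicator (B \<inter> ?F) x \<partial>?P V)"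
    by (rule nn_integral_indicator[symmetric]) (use B F in auto)
  also have "\<dots> = (\<integral>\<^sup>+x. (\<integral>\<^sup>+y. indicator (B \<inter> ?F) (x(u := y)) \<partial>unif) \<partial>?P V')"
    unfolding V(1) by (rule product_nn_integral_insert) (use V(2,3) BF in \<open>simp_all add: V(1)\<close>)
  \<comment> \<open>The value 0 is an arbitrary filler, as \<open>B\<close> ignores entry
    \<open>u\<close>. The integrands agree only almost surely, since the arc length formula needs
    \<open>x v\<close> in \<open>{0..<1}\<close>.\<close>
  also have "\<dots> = (\<integral>\<^sup>+x. indicator B (x(u := 0)) * ennreal (1 - q) \<partial>?P V')"
  proof (rule nn_integral_cong_AE)
    show "AE x in ?P V'. (\<integral>\<^sup>+y. indicator (B \<inter> ?F) (x(u := y)) \<partial>unif) =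
        indicator B (x(u := 0)) * ennreal (1 - q)"
      using AE_PiM_unif[OF V(3,4)] AE_space
    proof eventually_elim
      case (elim x)
      have sp: "x(u := y) \<in> space (?P V)" for y
        using measurable_space[OF upd elim(2)] .
      have "indicator (B \<inter> ?F) (x(u := y)) =
         (indicator B (x(u := 0)) * indicator {b. q / 2 < circle_dist (x v) b} y :: ennreal)" for y
        using B_indep[of x y] B_indep[of x 0] sp[of y] assms(4)
        by (auto simp: indicator_def)
      then have "(\<integral>\<^sup>+y. indicator (B \<inter> ?F) (x(u := y)) \<partial>unif) =
         (\<integral>\<^sup>+y. indicator B (x(u := 0)) * indicator {b. q / 2 < circle_dist (x v) b} y \<partial>unif)"
        by simp
      also have "\<dots> = indicator B (x(u := 0)) * emeasure unif {b. q / 2 < circle_dist (x v) b}"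
        by (subst nn_integral_cmult) auto
      also have "\<dots> = indicator B (x(u := 0)) * ennreal (1 - q)"
        using elim assms by (subst emeasure_unif_circle_dist) auto
      finally show ?case .
    qed
  qed
  also have "\<dots> = (\<integral>\<^sup>+x. (\<integral>\<^sup>+y. indicator B (x(u := y)) \<partial>unif) \<partial>?P V') * ennreal (1 - q)"
  proof -
    have "(\<integral>\<^sup>+y. indicator B (x(u := y)) \<partial>unif) = (indicator B (x(u := 0)) :: ennreal)" for x
    proof -
      have "indicator B (x(u := y)) = (indicator B (x(u := 0)) :: ennreal)" for y
        using B_indep[of x y] B_indep[of x 0] by (auto simp: indicator_def)
      then have "(\<integral>\<^sup>+y. indicator B (x(u := y)) \<partial>unif) =
          (\<integral>\<^sup>+y. (indicator B (x(u := 0)) :: ennreal) \<partial>unif)"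
        by (intro nn_integral_cong)
      also have "\<dots> = indicator B (x(u := 0))"
        by (simp only: nn_integral_const U.emeasure_space_1 mult_1_right)
      finally show ?thesis .
    qed
    moreover have "(\<lambda>x. indicator B (x(u := 0)) :: ennreal) \<in> borel_measurable (?P V')"
      by (rule measurable_compose[OF upd borel_measurable_indicator[OF B]])
    ultimately show ?thesis by (simp add: nn_integral_multc)
  qed
  also have "\<dots> = (\<integral>\<^sup>+x. indicator B x \<partial>?P V) * ennreal (1 - q)"
    unfolding V(1)
    by (subst product_nn_integral_insert) (use V(2,3) B in \<open>simp_all add: V(1)\<close>)
  also have "\<dots> = emeasure (?P V) B * ennreal (1 - q)"
    using B by simp
  finally have "emeasure (?P V) (B \<inter> ?F) = emeasure (?P V) B * ennreal (1 - q)" .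
  moreover have "B \<inter> ?F = B \<inter> {x. q / 2 < circle_dist (x v) (x u)}"
    using sets.sets_into_space[OF B] by auto
  ultimately show ?thesis
    using assms by (simp add: measure_def enn2real_mult)
qed

text \<open>Bonferroni from pairwise independence, which is what edges sharing a triangle provide.
  The parts \<open>C e\<close>, where \<open>e\<close> alone occurs, are disjoint, and each loses at
  most \<open>\<epsilon> e\<close> times the total sum.\<close>

lemma (in prob_space) prob_UNION_pairwise_indep_ge:
  fixes \<epsilon> :: "'e \<Rightarrow> real"
  assumes "finite E" and ev: "\<And>e. e \<in> E \<Longrightarrow> B e \<in> events"
    and prob: "\<And>e. e \<in> E \<Longrightarrow> prob (B e) = \<epsilon> e"
    and indep: "\<And>e e'. e \<in> E \<Longrightarrow> e' \<in> E \<Longrightarrow> e \<noteq> e' \<Longrightarrow> prob (B e \<inter> B e') = \<epsilon> e * \<epsilon> e'"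
  shows "prob (\<Union>e\<in>E. B e) \<ge> (\<Sum>e\<in>E. \<epsilon> e) * (1 - (\<Sum>e\<in>E. \<epsilon> e))"
proof -
  define C where "C e = B e - (\<Union>e'\<in>E - {e}. B e \<inter> B e')" for e
  have Cev: "C e \<in> events" if "e \<in> E" for e
    unfolding C_def using assms that by (intro sets.Diff sets.finite_UN sets.Int) auto
  have nonneg: "\<epsilon> e \<ge> 0" if "e \<in> E" for e
    using prob[OF that] measure_nonneg[of M "B e"] by simp
  have "\<epsilon> e * (1 - (\<Sum>e'\<in>E. \<epsilon> e')) \<le> prob (C e)" if e: "e \<in> E" for e
  proof -
    have U: "(\<Union>e'\<in>E - {e}. B e \<inter> B e') \<in> events"
      using assms that by (intro sets.finite_UN sets.Int) auto
    have "prob (\<Union>e'\<in>E - {e}. B e \<inter> B e') \<le> (\<Sum>e'\<in>E - {e}. prob (B e \<inter> B e'))"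
      using assms e by (intro finite_measure_subadditive_finite) auto
    also have "\<dots> = \<epsilon> e * (\<Sum>e'\<in>E - {e}. \<epsilon> e')"
      unfolding sum_distrib_left using e by (intro sum.cong refl indep) auto
    also have "\<dots> \<le> \<epsilon> e * (\<Sum>e'\<in>E. \<epsilon> e')"
      using assms(1) e nonneg by (intro mult_left_mono sum_mono2) auto
    finally show ?thesis
      unfolding C_def using U ev[OF e] prob[OF e]
      by (subst finite_measure_Diff) (auto simp: algebra_simps)
  qed
  then have "(\<Sum>e\<in>E. \<epsilon> e) * (1 - (\<Sum>e\<in>E. \<epsilon> e)) \<le> (\<Sum>e\<in>E. prob (C e))"
    unfolding sum_distrib_right by (intro sum_mono)
  also have "\<dots> = prob (\<Union>e\<in>E. C e)"
    using assms(1) Cev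
    by (intro finite_measure_finite_Union[symmetric]) (auto simp: disjoint_family_on_def C_def)
  also have "\<dots> \<le> prob (\<Union>e\<in>E. B e)"
    using assms(1) ev by (intro finite_measure_mono sets.finite_UN) (auto simp: C_def)
  finally show ?thesis .
qed

text \<open>Both sides are compared with an exponential. There are two losses: \<open>1 - s\<close>
  against 1 costs the factor \<open>1 - m * \<epsilon>0\<close>, and \<open>1 - q e\<close> against
  \<open>- ln (q e)\<close> costs \<open>1 - \<epsilon>0\<close>. The exponent \<gamma> has to
  absorb their product.\<close>

lemma one_minus_le_prod_powr:
  fixes q :: "'e \<Rightarrow> real" and \<gamma> \<epsilon>0 :: real
  assumes "finite E" and q: "\<And>e. e \<in> E \<Longrightarrow> 1 - \<epsilon>0 \<le> q e" "\<And>e. e \<in> E \<Longrightarrow> q e \<le> 1"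
    and \<epsilon>0: "0 \<le> \<epsilon>0" "\<epsilon>0 < 1" and card: "real (card E) \<le> m"
    and \<gamma>: "0 \<le> \<gamma>" "\<gamma> \<le> (1 - m * \<epsilon>0) * (1 - \<epsilon>0)"
  shows "1 - (\<Sum>e\<in>E. 1 - q e) * (1 - (\<Sum>e\<in>E. 1 - q e)) \<le> (\<Prod>e\<in>E. q e powr \<gamma>)"
proof -
  define s where "s = (\<Sum>e\<in>E. 1 - q e)"
  have qpos: "q e > 0" if "e \<in> E" for e
    using q(1)[OF that] \<epsilon>0 by linarith
  have s0: "s \<ge> 0"
    unfolding s_def using q(2) by (intro sum_nonneg) auto
  have "s \<le> (\<Sum>e\<in>E. \<epsilon>0)"
    unfolding s_def using q(1) by (intro sum_mono) (simp add: algebra_simps)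
  also have "\<dots> \<le> m * \<epsilon>0"
    using card \<epsilon>0 by (simp add: mult_right_mono)
  finally have s1: "s \<le> m * \<epsilon>0" .
  have m1: "1 - m * \<epsilon>0 \<ge> 0"
    using \<gamma> \<epsilon>0 by (smt (verit) mult_pos_neg mult_nonneg_nonneg zero_le_mult_iff)
  have ln_ge: "- (1 - q e) * (1 - m * \<epsilon>0) \<le> \<gamma> * ln (q e)" if e: "e \<in> E" for e
  proof -
    have "ln (inverse (q e)) \<le> inverse (q e) - 1"
      using qpos[OF e] by (intro ln_le_minus_one) auto
    then have "- ln (q e) \<le> inverse (q e) - 1"
      by (simp only: ln_inverse)
    from mult_right_mono[OF this, of "q e"] have "- ln (q e) * q e \<le> 1 - q e"
      using qpos[OF e] by (simp add: left_diff_distrib)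
    moreover have "- ln (q e) * (1 - \<epsilon>0) \<le> - ln (q e) * q e"
      using q[OF e] qpos[OF e] by (intro mult_left_mono) auto
    ultimately have "- ln (q e) * (1 - \<epsilon>0) \<le> 1 - q e" by linarith
    then have "(- ln (q e) * (1 - \<epsilon>0)) * (1 - m * \<epsilon>0) \<le> (1 - q e) * (1 - m * \<epsilon>0)"
      using m1 by (rule mult_right_mono)
    moreover have "- ln (q e) * \<gamma> \<le> - ln (q e) * ((1 - m * \<epsilon>0) * (1 - \<epsilon>0))"
      using \<gamma> q[OF e] qpos[OF e] by (intro mult_left_mono) auto
    ultimately show ?thesis by (simp add: algebra_simps)
  qed
  have "1 - s * (1 - s) \<le> 1 - s * (1 - m * \<epsilon>0)"
    using s0 s1 by (simp add: mult_left_mono)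
  also have "\<dots> \<le> exp (- s * (1 - m * \<epsilon>0))"
    using exp_ge_add_one_self[of "- s * (1 - m * \<epsilon>0)"] by simp
  also have "- s * (1 - m * \<epsilon>0) = (\<Sum>e\<in>E. - (1 - q e) * (1 - m * \<epsilon>0))"
    by (simp only: s_def sum_distrib_right sum_negf[symmetric])
  also have "exp \<dots> \<le> exp (\<Sum>e\<in>E. \<gamma> * ln (q e))"
    using ln_ge by (simp add: sum_mono)
  also have "\<dots> = (\<Prod>e\<in>E. q e powr \<gamma>)"
    using assms(1) qpos by (auto simp: exp_sum powr_def intro!: prod.cong dest!: qpos)
  finally show ?thesis by (simp add: s_def)
qed

text \<open>Increasing pairs list every edge of the complete graph once, so sums and products over
  edges do not count twice.\<close>

definition edges :: "nat set \<Rightarrow> (nat \<times> nat) set" where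
  "edges V = {(u, v). u \<in> V \<and> v \<in> V \<and> u < v}"

lemma finite_edges: "finite V \<Longrightarrow> finite (edges V)"
  by (rule finite_subset[of _ "V \<times> V"]) (auto simp: edges_def)

lemma prob_coordinate_clique_le:
  fixes V :: "nat set" and q :: "nat \<times> nat \<Rightarrow> real"
  assumes "finite V" and q: "\<And>e. e \<in> edges V \<Longrightarrow> 1 - \<epsilon>0 \<le> q e" "\<And>e. e \<in> edges V \<Longrightarrow> q e \<le> 1"
    and \<epsilon>0: "0 \<le> \<epsilon>0" "\<epsilon>0 < 1" and card: "real (card (edges V)) \<le> m"
    and \<gamma>: "0 \<le> \<gamma>" "\<gamma> \<le> (1 - m * \<epsilon>0) * (1 - \<epsilon>0)"
  shows "measure (\<Pi>\<^sub>M v\<in>V. unif) {x \<in> space (\<Pi>\<^sub>M v\<in>V. unif).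
      \<forall>(u, v)\<in>edges V. circle_dist (x u) (x v) \<le> q (u, v) / 2} \<le> (\<Prod>e\<in>edges V. q e powr \<gamma>)"
proof -
  let ?P = "\<Pi>\<^sub>M v\<in>V. unif"
  interpret U: prob_space unif by (rule prob_space_unif)
  interpret P: prob_space ?P by (intro prob_space_PiM prob_space_unif)
  define B where "B e = {x \<in> space ?P. q e / 2 < circle_dist (x (fst e)) (x (snd e))}" for e
  have ev: "B e \<in> sets ?P" if "e \<in> edges V" for e
    unfolding B_def using that by (auto simp: edges_def) measurable
  have q0: "0 \<le> q e" if "e \<in> edges V" for e
    using q(1)[OF that] \<epsilon>0 by linarith
  have step: "measure ?P (S \<inter> B e) = measure ?P S * (1 - q e)"
    if e: "e \<in> edges V" and S: "S \<in> sets ?P"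
      and "(\<forall>x y. x \<in> S \<longleftrightarrow> x(fst e := y) \<in> S) \<or> (\<forall>x y. x \<in> S \<longleftrightarrow> x(snd e := y) \<in> S)" for e S
  proof -
    have mem: "fst e \<in> V" "snd e \<in> V" "fst e \<noteq> snd e"
      using e by (auto simp: edges_def)
    have "S \<inter> B e = S \<inter> {x. q e / 2 < circle_dist (x (fst e)) (x (snd e))}"
      using sets.sets_into_space[OF S] by (auto simp: B_def)
    moreover have "\<dots> = S \<inter> {x. q e / 2 < circle_dist (x (snd e)) (x (fst e))}"
      by (simp add: circle_dist_commute)
    ultimately show ?thesis
      using that(3) prob_far_Int[OF assms(1) mem(2,1) mem(3)[symmetric] q0[OF e] q(2)[OF e] S]
        prob_far_Int[OF assms(1) mem(1,2) mem(3) q0[OF e] q(2)[OF e] S] by auto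
  qed
  have upd_space: "x \<in> space ?P \<longleftrightarrow> x(u := y) \<in> space ?P" if "u \<in> V" for x y u
    using that by (auto simp: space_PiM PiE_def extensional_def)
  have prob: "measure ?P (B e) = 1 - q e" if e: "e \<in> edges V" for e
  proof -
    have "fst e \<in> V" using e by (auto simp: edges_def)
    then have "measure ?P (space ?P \<inter> B e) = measure ?P (space ?P) * (1 - q e)"
      using upd_space e by (intro step) blast+
    then show ?thesis
      using sets.sets_into_space[OF ev[OF e]] by (simp add: P.prob_space Int_absorb1)
  qed
  have indep: "measure ?P (B e \<inter> B e') = (1 - q e) * (1 - q e')"
    if e: "e \<in> edges V" "e' \<in> edges V" "e \<noteq> e'" for e e'
  proof -
    \<comment> \<open>Distinct edges share at most one vertex, so \<open>e'\<close> has an endpoint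
      off \<open>e\<close>. Overwriting the position of that endpoint leaves \<open>B e\<close>
      unchanged.\<close>
    have "fst e' \<notin> {fst e, snd e} \<or> snd e' \<notin> {fst e, snd e}"
      using e by (auto simp: edges_def)
    moreover have "fst e' \<in> V" "snd e' \<in> V"
      using e by (auto simp: edges_def)
    ultimately have "(\<forall>x y. x \<in> B e \<longleftrightarrow> x(fst e' := y) \<in> B e) \<or>
        (\<forall>x y. x \<in> B e \<longleftrightarrow> x(snd e' := y) \<in> B e)"
      using upd_space unfolding B_def by auto
    with e show ?thesis
      using step[OF e(2) ev[OF e(1)]] prob[OF e(1)] by simp
  qed
  have "{x \<in> space ?P. \<forall>(u, v)\<in>edges V. circle_dist (x u) (x v) \<le> q (u, v) / 2} =
      space ?P - (\<Union>e\<in>edges V. B e)"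
    by (fastforce simp: B_def not_less)
  moreover have "measure ?P (space ?P - (\<Union>e\<in>edges V. B e)) = 1 - measure ?P (\<Union>e\<in>edges V. B e)"
    using ev finite_edges[OF assms(1)] by (intro P.prob_compl sets.finite_UN) auto
  moreover have "measure ?P (\<Union>e\<in>edges V. B e) \<ge>
      (\<Sum>e\<in>edges V. 1 - q e) * (1 - (\<Sum>e\<in>edges V. 1 - q e))"
    by (rule P.prob_UNION_pairwise_indep_ge) (use finite_edges[OF assms(1)] ev prob indep in auto)
  moreover have "1 - (\<Sum>e\<in>edges V. 1 - q e) * (1 - (\<Sum>e\<in>edges V. 1 - q e)) \<le>
      (\<Prod>e\<in>edges V. q e powr \<gamma>)"
    by (rule one_minus_le_prod_powr[OF finite_edges[OF assms(1)] q \<epsilon>0 card \<gamma>])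
  ultimately show ?thesis by simp
qed

section \<open>Separating weights and coordinates\<close>

text \<open>Both sides of the next identity are transported to the flat product over all
  pairs (coordinate, vertex), where coordinate \<open>d\<close> stands for the weight.\<close>

lemma emeasure_vertex_product_eq:
  fixes V :: "nat set" and W :: "real measure" and r :: "real \<Rightarrow> real \<Rightarrow> real"
  assumes "finite V" and W: "prob_space W" and sets_W: "sets W = sets borel"
    and r [measurable]: "case_prod r \<in> borel_measurable (borel \<Otimes>\<^sub>M borel)"
  shows "emeasure (\<Pi>\<^sub>M v\<in>V. W \<Otimes>\<^sub>M torus_measure d)
      {\<omega> \<in> space (\<Pi>\<^sub>M v\<in>V. W \<Otimes>\<^sub>M torus_measure d). \<forall>(u, v)\<in>edges V. \<forall>i<d.
        circle_dist (snd (\<omega> u) i) (snd (\<omega> v) i) \<le> r (fst (\<omega> u)) (fst (\<omega> v))}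
    = (\<integral>\<^sup>+y. emeasure (\<Pi>\<^sub>M v\<in>V. unif) {x \<in> space (\<Pi>\<^sub>M v\<in>V. unif).
        \<forall>(u, v)\<in>edges V. circle_dist (x u) (x v) \<le> r (y u) (y v)} ^ d \<partial>(\<Pi>\<^sub>M v\<in>V. W))"
    (is "emeasure ?Q ?EQ = _")
proof -
  define M where "M i = (if i = d then W else unif)" for i :: nat
  let ?J = "{..<Suc d} \<times> V"
  let ?flat = "\<Pi>\<^sub>M j\<in>?J. M (fst j)"
  let ?R = "\<Pi>\<^sub>M i\<in>{..<Suc d}. \<Pi>\<^sub>M v\<in>V. M i"
  have finJ: "finite ?J" using assms(1) by auto
  have prob_M: "prob_space (M i)" for i
    using W prob_space_unif by (simp add: M_def)
  have sets_M [measurable_cong]: "sets (M i) = sets borel" for i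
    using sets_W by (simp add: M_def)
  note sets_W [measurable_cong]
  have space_M: "space (M i) = UNIV" for i
    using sets_eq_imp_space_eq[OF sets_M] by simp
  have space_W: "space W = UNIV"
    using sets_eq_imp_space_eq[OF sets_W] by simp
  have sets_torus [measurable_cong]: "sets (torus_measure d) = sets (\<Pi>\<^sub>M i\<in>{..<d}. borel)"
    unfolding torus_measure_def by (rule sets_PiM_cong) auto
  interpret W: prob_space W by fact
  interpret T: prob_space "torus_measure d" by (rule prob_space_torus_measure)
  interpret WT: pair_prob_space W "torus_measure d" ..
  interpret F: product_prob_space "\<lambda>j::nat \<times> nat. M (fst j)" ?J
    using prob_M by (simp add: product_prob_space_def product_prob_space_axioms_def
        product_sigma_finite_def prob_space_imp_sigma_finite)
  interpret Q: product_prob_space "\<lambda>v::nat. W \<Otimes>\<^sub>M torus_measure d" V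
    by unfold_locales
  interpret U: product_prob_space "\<lambda>i::nat. unif" "{..<d}"
    using prob_space_unif by (simp add: product_prob_space_def product_prob_space_axioms_def
        product_sigma_finite_def prob_space_imp_sigma_finite)
  have prob_PM: "prob_space (\<Pi>\<^sub>M v\<in>V. M i)" for i
    by (intro prob_space_PiM prob_M)
  interpret R: product_prob_space "\<lambda>i::nat. \<Pi>\<^sub>M v\<in>V. M i" "{..<Suc d}"
    using prob_PM by (simp add: product_prob_space_def product_prob_space_axioms_def
        product_sigma_finite_def prob_space_imp_sigma_finite)
  have PM: "product_sigma_finite (\<lambda>v::nat. M i)" for i
    using prob_M by (simp add: product_sigma_finite_def prob_space_imp_sigma_finite)
  define \<Phi> where "\<Phi> \<omega> = (\<lambda>j\<in>?J. if fst j = d then fst (\<omega> (snd j)) else snd (\<omega> (snd j)) (fst j))"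
    for \<omega> :: girg_outcome
  define \<Psi> where "\<Psi> \<rho> = (\<lambda>j\<in>?J. \<rho> (fst j) (snd j))" for \<rho> :: "nat \<Rightarrow> nat \<Rightarrow> real"
  have meas_\<Phi> [measurable]: "\<Phi> \<in> measurable ?Q ?flat"
    unfolding \<Phi>_def
  proof (rule measurable_restrict)
    fix j assume j: "j \<in> ?J"
    show "(\<lambda>\<omega>. if fst j = d then fst (\<omega> (snd j)) else snd (\<omega> (snd j)) (fst j))
        \<in> measurable ?Q (M (fst j))"
    proof (cases "fst j = d")
      case True
      then show ?thesis using j by auto
    next
      case False
      then have "(\<lambda>x. x (fst j)) \<in> measurable (torus_measure d) borel"
        using j by auto
      moreover have "(\<lambda>\<omega>. snd (\<omega> (snd j))) \<in> measurable ?Q (torus_measure d)"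
        using j by auto
      ultimately have "(\<lambda>\<omega>. snd (\<omega> (snd j)) (fst j)) \<in> borel_measurable ?Q"
        by (rule measurable_compose[rotated])
      then show ?thesis
        using False by (simp add: measurable_cong_sets[OF refl sets_M])
    qed
  qed
  have meas_\<Psi> [measurable]: "\<Psi> \<in> measurable ?R ?flat"
    unfolding \<Psi>_def
  proof (rule measurable_restrict)
    fix j assume j: "j \<in> ?J"
    have "(\<lambda>\<rho>. \<rho> (fst j)) \<in> measurable ?R (\<Pi>\<^sub>M v\<in>V. M (fst j))"
      using j by (intro measurable_component_singleton) auto
    moreover have "(\<lambda>x. x (snd j)) \<in> measurable (\<Pi>\<^sub>M v\<in>V. M (fst j)) (M (fst j))"
      using j by (intro measurable_component_singleton) auto
    ultimately show "(\<lambda>\<rho>. \<rho> (fst j) (snd j)) \<in> measurable ?R (M (fst j))"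
      by (rule measurable_compose)
  qed
  \<comment> \<open>A finite product of probability measures is determined by its values on boxes,
    so for each relabelling it suffices to compute the preimage of a box.\<close>
  have \<Phi>: "distr ?Q ?flat \<Phi> = ?flat"
  proof (rule F.PiM_eqI[OF finJ])
    fix A assume A: "\<And>j. j \<in> ?J \<Longrightarrow> A j \<in> sets (M (fst j))"
    have PA: "Pi\<^sub>E {..<d} (\<lambda>i. A (i, v)) \<in> sets (torus_measure d)" if "v \<in> V" for v
      unfolding torus_measure_def using A that by (intro sets_PiM_I_finite) (auto simp: sets_M)
    have Ad: "A (d, v) \<in> sets W" if "v \<in> V" for v
      using A[of "(d, v)"] that by (simp add: M_def)
    have "\<Phi> -` Pi\<^sub>E ?J A \<inter> space ?Q =
        Pi\<^sub>E V (\<lambda>v. A (d, v) \<times> Pi\<^sub>E {..<d} (\<lambda>i. A (i, v)))" (is "?L = ?R")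
    proof (intro set_eqI iffI)
      fix \<omega> assume "\<omega> \<in> ?L"
      then have 1: "\<And>j. j \<in> ?J \<Longrightarrow> \<Phi> \<omega> j \<in> A j" and 2: "\<omega> \<in> space ?Q"
        by (auto simp: PiE_def)
      show "\<omega> \<in> ?R"
      proof (rule PiE_I)
        fix v assume v: "v \<in> V"
        have "(\<lambda>\<omega>. snd (\<omega> v)) \<in> measurable ?Q (torus_measure d)"
          using v by auto
        from measurable_space[OF this 2] have ext: "snd (\<omega> v) \<in> extensional {..<d}"
          by (simp add: torus_measure_def space_PiM PiE_def)
        have "snd (\<omega> v) i \<in> A (i, v)" if "i < d" for i
          using 1[of "(i, v)"] that v by (auto simp: \<Phi>_def)
        moreover have "fst (\<omega> v) \<in> A (d, v)"
          using 1[of "(d, v)"] v by (auto simp: \<Phi>_def)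
        ultimately show "\<omega> v \<in> A (d, v) \<times> Pi\<^sub>E {..<d} (\<lambda>i. A (i, v))"
          using ext by (auto simp: mem_Times_iff PiE_def)
      next
        fix v assume "v \<notin> V"
        then show "\<omega> v = undefined"
          using 2 by (auto simp: space_PiM PiE_def extensional_def)
      qed
    next
      fix \<omega> assume \<omega>: "\<omega> \<in> ?R"
      have "\<omega> v \<in> space (W \<Otimes>\<^sub>M torus_measure d)" if v: "v \<in> V" for v
      proof -
        have "\<omega> v \<in> A (d, v) \<times> Pi\<^sub>E {..<d} (\<lambda>i. A (i, v))"
          using \<omega> v by (rule PiE_mem)
        then show ?thesis
          using sets.sets_into_space[OF PA[OF v]] by (auto simp: space_pair_measure space_W)
      qed
      with \<omega> have "\<omega> \<in> space ?Q"
        by (auto simp: space_PiM PiE_def)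
      moreover have "\<Phi> \<omega> \<in> Pi\<^sub>E ?J A"
      proof (rule PiE_I)
        fix j assume j: "j \<in> ?J"
        then have "fst (\<omega> (snd j)) \<in> A (d, snd j)"
          "\<And>i. i < d \<Longrightarrow> snd (\<omega> (snd j)) i \<in> A (i, snd j)"
          using \<omega> by (auto simp: PiE_def Pi_iff mem_Times_iff)
        with j show "\<Phi> \<omega> j \<in> A j"
          by (cases j) (auto simp: \<Phi>_def less_Suc_eq)
      qed (auto simp: \<Phi>_def)
      ultimately show "\<omega> \<in> ?L" by auto
    qed
    then have "emeasure (distr ?Q ?flat \<Phi>) (Pi\<^sub>E ?J A) =
        emeasure ?Q (Pi\<^sub>E V (\<lambda>v. A (d, v) \<times> Pi\<^sub>E {..<d} (\<lambda>i. A (i, v))))"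
      using A finJ by (subst emeasure_distr) (auto intro!: sets_PiM_I_finite)
    also have "\<dots> = (\<Prod>v\<in>V. emeasure (W \<Otimes>\<^sub>M torus_measure d)
        (A (d, v) \<times> Pi\<^sub>E {..<d} (\<lambda>i. A (i, v))))"
      using assms(1) Ad PA by (intro Q.emeasure_PiM pair_measureI) auto
    also have "\<dots> = (\<Prod>v\<in>V. emeasure W (A (d, v)) * (\<Prod>i<d. emeasure unif (A (i, v))))"
    proof (intro prod.cong refl)
      fix v assume v: "v \<in> V"
      have "emeasure (torus_measure d) (Pi\<^sub>E {..<d} (\<lambda>i. A (i, v))) =
          (\<Prod>i<d. emeasure unif (A (i, v)))"
        unfolding torus_measure_def using A v by (intro U.emeasure_PiM) (auto simp: sets_M)
      then show "emeasure (W \<Otimes>\<^sub>M torus_measure d) (A (d, v) \<times> Pi\<^sub>E {..<d} (\<lambda>i. A (i, v))) =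
          emeasure W (A (d, v)) * (\<Prod>i<d. emeasure unif (A (i, v)))"
        using Ad[OF v] PA[OF v] by (simp add: T.emeasure_pair_measure_Times)
    qed
    also have "\<dots> = (\<Prod>v\<in>V. \<Prod>i<Suc d. emeasure (M i) (A (i, v)))"
      by (intro prod.cong refl)
        (auto simp: M_def mult.commute intro!: arg_cong2[where f = "(*)"] prod.cong)
    also have "\<dots> = (\<Prod>j\<in>?J. emeasure (M (fst j)) (A j))"
      by (subst prod.swap) (simp add: prod.cartesian_product split_beta del: prod.lessThan_Suc)
    finally show "emeasure (distr ?Q ?flat \<Phi>) (Pi\<^sub>E ?J A) = (\<Prod>j\<in>?J. emeasure (M (fst j)) (A j))" .
  qed simp
  have \<Psi>: "distr ?R ?flat \<Psi> = ?flat"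
  proof (rule F.PiM_eqI[OF finJ])
    fix A assume A: "\<And>j. j \<in> ?J \<Longrightarrow> A j \<in> sets (M (fst j))"
    have PA: "Pi\<^sub>E V (\<lambda>v. A (i, v)) \<in> sets (\<Pi>\<^sub>M v\<in>V. M i)" if "i < Suc d" for i
      using A assms(1) that by (intro sets_PiM_I_finite) auto
    have "\<Psi> -` Pi\<^sub>E ?J A \<inter> space ?R = Pi\<^sub>E {..<Suc d} (\<lambda>i. Pi\<^sub>E V (\<lambda>v. A (i, v)))"
      by (auto simp: \<Psi>_def space_PiM space_M PiE_def Pi_iff)
    then have "emeasure (distr ?R ?flat \<Psi>) (Pi\<^sub>E ?J A) =
        emeasure ?R (Pi\<^sub>E {..<Suc d} (\<lambda>i. Pi\<^sub>E V (\<lambda>v. A (i, v))))"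
      using A finJ by (subst emeasure_distr) (auto intro!: sets_PiM_I_finite)
    also have "\<dots> = (\<Prod>i<Suc d. emeasure (\<Pi>\<^sub>M v\<in>V. M i) (Pi\<^sub>E V (\<lambda>v. A (i, v))))"
      using PA by (intro R.emeasure_PiM) auto
    also have "\<dots> = (\<Prod>i<Suc d. \<Prod>v\<in>V. emeasure (M i) (A (i, v)))"
      using A assms(1) by (intro prod.cong refl product_sigma_finite.emeasure_PiM[OF PM]) auto
    also have "\<dots> = (\<Prod>j\<in>?J. emeasure (M (fst j)) (A j))"
      by (simp add: prod.cartesian_product split_beta del: prod.lessThan_Suc)
    finally show "emeasure (distr ?R ?flat \<Psi>) (Pi\<^sub>E ?J A) = (\<Prod>j\<in>?J. emeasure (M (fst j)) (A j))" .
  qed simp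
  define E where "E = {\<phi> \<in> space ?flat. \<forall>e\<in>edges V. \<forall>i\<in>{..<d}.
      circle_dist (\<phi> (i, fst e)) (\<phi> (i, snd e)) \<le> r (\<phi> (d, fst e)) (\<phi> (d, snd e))}"
  have E [measurable]: "E \<in> sets ?flat"
    unfolding E_def
  proof (intro sets.sets_Collect_finite_All)
    fix e i assume "e \<in> edges V" "i \<in> {..<d}"
    then have *: "(i, fst e) \<in> ?J" "(i, snd e) \<in> ?J" "(d, fst e) \<in> ?J" "(d, snd e) \<in> ?J"
      by (auto simp: edges_def)
    have c: "(\<lambda>\<phi>. \<phi> j) \<in> borel_measurable ?flat" if "j \<in> ?J" for j
      using measurable_component_singleton[OF that, of "\<lambda>j. M (fst j)"]
        measurable_cong_sets[OF refl sets_M] by blast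
    note c[OF *(1), measurable] c[OF *(2), measurable] c[OF *(3), measurable] c[OF *(4), measurable]
    show "{\<phi> \<in> space ?flat. circle_dist (\<phi> (i, fst e)) (\<phi> (i, snd e))
        \<le> r (\<phi> (d, fst e)) (\<phi> (d, snd e))} \<in> sets ?flat"
      by measurable
  qed (auto simp: finite_edges assms(1))
  have "?EQ = \<Phi> -` E \<inter> space ?Q"
    using measurable_space[OF meas_\<Phi>]
    by (auto simp: E_def \<Phi>_def edges_def)
  then have "emeasure ?Q ?EQ = emeasure (distr ?Q ?flat \<Phi>) E"
    by (simp add: emeasure_distr)
  also have "\<dots> = emeasure (distr ?R ?flat \<Psi>) E"
    by (simp only: \<Phi> \<Psi>)
  also have "\<dots> = emeasure ?R (\<Psi> -` E \<inter> space ?R)"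
    by (simp add: emeasure_distr)
  also have "\<dots> = (\<integral>\<^sup>+\<rho>. indicator (\<Psi> -` E \<inter> space ?R) \<rho> \<partial>?R)"
    by (rule nn_integral_indicator[symmetric]) measurable
  \<comment> \<open>The weight slot \<open>d\<close> becomes the outer integral. With the weights
    \<open>y\<close> fixed, the condition treats the \<open>d\<close> coordinates separately and
    identically, so the inner event is a box with \<open>d\<close> equal sides and yields a
    \<open>d\<close>-th power.\<close>
  also have "\<dots> = (\<integral>\<^sup>+y. (\<integral>\<^sup>+x. indicator (\<Psi> -` E \<inter> space ?R) (x(d := y))
      \<partial>(\<Pi>\<^sub>M i\<in>{..<d}. \<Pi>\<^sub>M v\<in>V. M i)) \<partial>(\<Pi>\<^sub>M v\<in>V. M d))"
    unfolding lessThan_Suc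
    by (rule R.product_nn_integral_insert_rev) (use measurable_sets[OF meas_\<Psi> E] in \<open>auto simp: lessThan_Suc\<close>)
  also have "\<dots> = (\<integral>\<^sup>+y. emeasure (\<Pi>\<^sub>M v\<in>V. unif) {x \<in> space (\<Pi>\<^sub>M v\<in>V. unif).
        \<forall>(u, v)\<in>edges V. circle_dist (x u) (x v) \<le> r (y u) (y v)} ^ d \<partial>(\<Pi>\<^sub>M v\<in>V. M d))"
  proof (rule nn_integral_cong)
    fix y assume y: "y \<in> space (\<Pi>\<^sub>M v\<in>V. M d)"
    let ?P = "\<Pi>\<^sub>M v\<in>V. unif"
    let ?A = "{x \<in> space ?P. \<forall>(u, v)\<in>edges V. circle_dist (x u) (x v) \<le> r (y u) (y v)}"
    have A: "?A \<in> sets ?P"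
      unfolding case_prod_beta
    proof (intro sets.sets_Collect_finite_All)
      fix e assume "e \<in> edges V"
      then have [simp]: "fst e \<in> V" "snd e \<in> V" by (auto simp: edges_def)
      show "{x \<in> space ?P. circle_dist (x (fst e)) (x (snd e)) \<le> r (y (fst e)) (y (snd e))} \<in> sets ?P"
        by measurable
    qed (auto simp: finite_edges assms(1))
    have eqM: "(\<Pi>\<^sub>M i\<in>{..<d}. \<Pi>\<^sub>M v\<in>V. M i) = (\<Pi>\<^sub>M i\<in>{..<d}. ?P)"
      by (intro PiM_cong) (auto simp: M_def)
    have prP: "prob_space ?P" by (intro prob_space_PiM prob_space_unif)
    interpret P: product_prob_space "\<lambda>i::nat. ?P" "{..<d}"
      using prP by (simp add: product_prob_space_def product_prob_space_axioms_def
        product_sigma_finite_def prob_space_imp_sigma_finite)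
    have "(\<integral>\<^sup>+x. indicator (\<Psi> -` E \<inter> space ?R) (x(d := y)) \<partial>(\<Pi>\<^sub>M i\<in>{..<d}. ?P)) =
        (\<integral>\<^sup>+x. indicator (Pi\<^sub>E {..<d} (\<lambda>i. ?A)) x \<partial>(\<Pi>\<^sub>M i\<in>{..<d}. ?P))"
    proof (rule nn_integral_cong)
      fix x assume x: "x \<in> space (\<Pi>\<^sub>M i\<in>{..<d}. ?P)"
      have sp: "x(d := y) \<in> space ?R"
        using x y by (auto simp: space_PiM space_M PiE_def Pi_iff extensional_def less_Suc_eq)
      have "x(d := y) \<in> \<Psi> -` E \<inter> space ?R \<longleftrightarrow> (\<forall>e\<in>edges V. \<forall>i\<in>{..<d}.
          circle_dist (x i (fst e)) (x i (snd e)) \<le> r (y (fst e)) (y (snd e)))"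
        using sp measurable_space[OF meas_\<Psi> sp] by (auto simp: E_def \<Psi>_def edges_def)
      also have "\<dots> \<longleftrightarrow> x \<in> Pi\<^sub>E {..<d} (\<lambda>i. ?A)"
        using x by (auto simp: space_PiM[of _ "\<lambda>_. ?P"] PiE_def Pi_iff split_beta)
      finally have "x(d := y) \<in> \<Psi> -` E \<inter> space ?R \<longleftrightarrow> x \<in> Pi\<^sub>E {..<d} (\<lambda>i. ?A)" .
      then show "indicator (\<Psi> -` E \<inter> space ?R) (x(d := y)) =
          (indicator (Pi\<^sub>E {..<d} (\<lambda>i. ?A)) x :: ennreal)"
        unfolding indicator_def by (simp only:)
    qed
    also have "\<dots> = emeasure (\<Pi>\<^sub>M i\<in>{..<d}. ?P) (Pi\<^sub>E {..<d} (\<lambda>i. ?A))"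
      using A by (intro nn_integral_indicator sets_PiM_I_finite) auto
    also have "\<dots> = (\<Prod>i<d. emeasure ?P ?A)"
      using A by (intro P.emeasure_PiM) auto
    finally show "(\<integral>\<^sup>+x. indicator (\<Psi> -` E \<inter> space ?R) (x(d := y))
        \<partial>(\<Pi>\<^sub>M i\<in>{..<d}. \<Pi>\<^sub>M v\<in>V. M i)) = emeasure ?P ?A ^ d"
      by (simp add: eqM)
  qed
  finally show ?thesis by (simp add: M_def)
qed

section \<open>Weight integrals\<close>

lemma prod_edges_insert:
  fixes h :: "nat \<Rightarrow> nat \<Rightarrow> real"
  assumes "finite A" "a \<notin> A" and sym: "\<And>u v. h u v = h v u"
  shows "(\<Prod>(u, v)\<in>edges (insert a A). h u v) = (\<Prod>(u, v)\<in>edges A. h u v) * (\<Prod>b\<in>A. h a b)"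
proof -
  let ?e = "\<lambda>b. (min a b, max a b)"
  have *: "edges (insert a A) = edges A \<union> ?e ` A"
  proof (intro set_eqI iffI)
    fix e assume e: "e \<in> edges (insert a A)"
    show "e \<in> edges A \<union> ?e ` A"
    proof (cases "e \<in> edges A")
      case False
      with e consider b where "b \<in> A" "e = (a, b)" "a < b" | b where "b \<in> A" "e = (b, a)" "b < a"
        by (auto simp: edges_def)
      then show ?thesis
        by cases (auto intro!: image_eqI)
    qed auto
  next
    fix e assume "e \<in> edges A \<union> ?e ` A"
    then show "e \<in> edges (insert a A)"
    proof
      assume "e \<in> ?e ` A"
      then obtain b where "b \<in> A" "e = ?e b" by auto
      then show ?thesis
        using assms(2) by (cases a b rule: linorder_cases) (auto simp: edges_def)
    qed (auto simp: edges_def)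
  qed
  have "inj_on ?e A"
    by (auto simp: inj_on_def min_def max_def split: if_splits)
  moreover have "edges A \<inter> ?e ` A = {}"
    using assms(2) by (auto simp: edges_def min_def max_def split: if_splits)
  ultimately have "(\<Prod>(u, v)\<in>edges (insert a A). h u v) =
      (\<Prod>(u, v)\<in>edges A. h u v) * (\<Prod>b\<in>A. h (min a b) (max a b))"
    unfolding * using assms(1) finite_edges[OF assms(1)]
    by (subst prod.union_disjoint) (auto simp: prod.reindex)
  \<comment> \<open>Edges are stored in increasing order; symmetry of \<open>h\<close> removes the
    reordering.\<close>
  also have "(\<Prod>b\<in>A. h (min a b) (max a b)) = (\<Prod>b\<in>A. h a b)"
    using sym by (intro prod.cong refl) (auto simp: min_def max_def)
  finally show ?thesis .
qed

lemma edges_empty [simp]: "edges {} = {}"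
  by (auto simp: edges_def)

lemma edges_mono: "A \<subseteq> B \<Longrightarrow> edges A \<subseteq> edges B"
  by (auto simp: edges_def)

text \<open>Every vertex of the complete graph on \<open>A\<close> lies on \<open>card A - 1\<close>
  edges.\<close>

lemma prod_edges_mult:
  fixes g :: "nat \<Rightarrow> real"
  assumes "finite A"
  shows "(\<Prod>(u, v)\<in>edges A. g u * g v) = (\<Prod>v\<in>A. g v ^ (card A - 1))"
  using assms
proof (induction A rule: finite_induct)
  case (insert a A)
  have "(\<Prod>(u, v)\<in>edges (insert a A). g u * g v) =
      (\<Prod>v\<in>A. g v ^ (card A - 1)) * (\<Prod>b\<in>A. g a * g b)"
    using insert by (subst prod_edges_insert) (auto simp: mult.commute)
  also have "\<dots> = g a ^ card A * (\<Prod>v\<in>A. g v ^ (card A - 1) * g v)"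
    by (simp add: prod.distrib)
  also have "(\<Prod>v\<in>A. g v ^ (card A - 1) * g v) = (\<Prod>v\<in>A. g v ^ card A)"
  proof (intro prod.cong refl)
    fix v assume "v \<in> A"
    then have "card A > 0" using insert.hyps by (auto simp: card_gt_0_iff)
    then show "g v ^ (card A - 1) * g v = g v ^ card A"
      by (metis power_minus_mult)
  qed
  finally show ?case using insert by simp
qed auto

lemma prod_le_prod_subset:
  fixes f :: "'a \<Rightarrow> real"
  assumes "finite A" "B \<subseteq> A" "\<And>a. a \<in> A \<Longrightarrow> 0 \<le> f a" "\<And>a. a \<in> A \<Longrightarrow> f a \<le> 1"
  shows "prod f A \<le> prod f B"
proof -
  have "prod f A = prod f (A - B) * prod f B"
    using assms by (intro prod.subset_diff)
  also have "\<dots> \<le> 1 * prod f B"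
    using assms by (intro mult_right_mono prod_le_1 prod_nonneg) auto
  finally show ?thesis by simp
qed

lemma prod_subset_le_prod:
  fixes f :: "'a \<Rightarrow> real"
  assumes "finite A" "B \<subseteq> A" "\<And>a. a \<in> A \<Longrightarrow> 0 \<le> f a" "\<And>a. a \<in> A - B \<Longrightarrow> 1 \<le> f a"
  shows "prod f B \<le> prod f A"
proof -
  have "1 * prod f B \<le> prod f (A - B) * prod f B"
    using assms by (intro mult_right_mono prod_ge_1 prod_nonneg) auto
  also have "\<dots> = prod f A"
    using assms by (intro prod.subset_diff[symmetric])
  finally show ?thesis by simp
qed

text \<open>Majorant for a single vertex: \<open>A\<close> is the exponent of light vertices and
  \<open>B\<close> that of heavy ones. A power tail with exponent strictly between \<open>B\<close>
  and \<open>A\<close> gives a finite mean, dominated by \<open>t\<close> of order 1.\<close>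

definition two_powr :: "real \<Rightarrow> real \<Rightarrow> real \<Rightarrow> real" where
  "two_powr A B t = (if t \<le> 1 then t powr A else t powr B)"

text \<open>The exponent \<open>s\<close> interpolates between the bounds 1 and \<open>t\<close>.
  Lowering it keeps the power of a heavy endpoint small at the expense of a light one.\<close>

lemma min_one_le_powr:
  fixes t s :: real
  assumes "0 < t" "0 \<le> s" "s \<le> 1"
  shows "min 1 t \<le> t powr s"
proof (cases "t \<le> 1")
  case True
  then have "t powr 1 \<le> t powr s"
    using assms by (intro powr_mono') auto
  with True assms show ?thesis by (simp add: min_def)
next
  case False
  then have "1 \<le> t powr s"
    using assms by (intro ge_one_powr_ge_zero) auto
  with False show ?thesis by simp
qed

text \<open>The exponents reflect the extremal configurations: two light vertices joined to one heavy
  vertex force the heavy weight to enter with exponent \<open>2 s\<close> below \<open>\<beta> - 1\<close>, while the light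
  weights keep an exponent close to \<open>1 + s\<close>, which is above \<open>\<beta> - 1\<close>.\<close>

lemma prod_edges_le_prod_two_powr:
  fixes x :: "nat \<Rightarrow> real" and s \<gamma> :: real
  assumes "finite V" "card V \<ge> 3" and pos: "\<And>v. v \<in> V \<Longrightarrow> 0 < x v"
    and s: "1 / 2 \<le> s" "s \<le> 1" and \<gamma>: "0 < \<gamma>" "\<gamma> \<le> 1"
  shows "(\<Prod>(u, v)\<in>edges V. min 1 (x u * x v) powr \<gamma>)
    \<le> (\<Prod>v\<in>V. two_powr (\<gamma> * (1 + s)) (2 * s) (x v))"
proof -
  define f where "f = two_powr (\<gamma> * (1 + s)) (2 * s)"
  define S where "S = {v \<in> V. x v < 1}"
  define m where "m u v = min 1 (x u * x v) powr \<gamma>" for u v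
  have m01: "0 \<le> m u v" "m u v \<le> 1" if "u \<in> V" "v \<in> V" for u v
    using pos[OF that(1)] pos[OF that(2)] \<gamma> by (auto simp: m_def intro!: powr_le1)
  have m_sym: "m u v = m v u" for u v
    by (simp add: m_def mult.commute)
  have f0: "0 \<le> f t" for t by (simp add: f_def two_powr_def)
  have f1: "1 \<le> f t" if "1 \<le> t" for t
    using that s by (auto simp: f_def two_powr_def intro!: ge_one_powr_ge_zero)
  have f_light: "t powr p \<le> f t" if "0 < t" "t \<le> 1" "\<gamma> * (1 + s) \<le> p" for t p
    using that by (auto simp: f_def two_powr_def intro!: powr_mono')
  have f_heavy: "t powr p \<le> f t" if "1 \<le> t" "p \<le> 2 * s" for t p
    using that by (auto simp: f_def two_powr_def intro!: powr_mono)
  have m_le: "m u v \<le> x u powr (\<sigma> * \<gamma>) * x v powr (\<sigma> * \<gamma>)"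
    if "u \<in> V" "v \<in> V" "0 \<le> \<sigma>" "\<sigma> \<le> 1" for u v \<sigma>
  proof -
    have xx: "0 < x u * x v" using pos that by simp
    have "m u v \<le> ((x u * x v) powr \<sigma>) powr \<gamma>"
      unfolding m_def using \<gamma> xx that by (intro powr_mono2 min_one_le_powr) auto
    also have "\<dots> = x u powr (\<sigma> * \<gamma>) * x v powr (\<sigma> * \<gamma>)"
      using pos that by (simp add: powr_powr powr_mult less_imp_le)
    finally show ?thesis .
  qed
  have m_le1: "m u v \<le> x u powr \<gamma> * x v powr \<gamma>" if "u \<in> V" "v \<in> V" for u v
    using m_le[OF that, of 1] by simp
  have powr_double: "y powr (2 * p) = y powr p * y powr p" for y p :: real
    by (simp only: powr_add[symmetric] mult_2)
  \<comment> \<open>Edge factors are at most 1, so edges outside \<open>T\<close> may be dropped;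
    heavy vertices have \<open>f\<close> at least 1, so they may be added on the right. It remains
    to find a set \<open>T\<close> that contains all light vertices and satisfies the bound.\<close>
  have reduce: ?thesis if T: "T \<subseteq> V" "S \<subseteq> T"
    and le: "(\<Prod>(u, v)\<in>edges T. m u v) \<le> (\<Prod>v\<in>T. f (x v))" for T
  proof -
    have "(\<Prod>(u, v)\<in>edges V. m u v) \<le> (\<Prod>(u, v)\<in>edges T. m u v)"
      using m01 T(1) finite_edges[OF assms(1)] edges_mono[OF T(1)]
      by (intro prod_le_prod_subset) (auto simp: edges_def)
    also note le
    also have "(\<Prod>v\<in>T. f (x v)) \<le> (\<Prod>v\<in>V. f (x v))"
    proof (intro prod_subset_le_prod f0 f1)
      fix v assume "v \<in> V - T"
      then show "1 \<le> x v" using T(2) by (force simp: S_def)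
    qed (use T assms(1) in auto)
    finally show ?thesis by (simp add: m_def f_def)
  qed
  have triple: "(\<Prod>(u, v)\<in>edges {a, b, c}. m u v) = m b c * (m a b * m a c)"
    if "a \<noteq> b" "a \<noteq> c" "b \<noteq> c" for a b c
  proof -
    have "edges {c} = {}"
      by (auto simp: edges_def)
    then show ?thesis
      using that m_sym
      by (simp add: prod_edges_insert[of "{b, c}" a] prod_edges_insert[of "{c}" b])
  qed
  have finS: "finite S" and SV: "S \<subseteq> V" using assms(1) by (auto simp: S_def)
  \<comment> \<open>Three or more light vertices serve as \<open>T\<close> by themselves: each has
    degree at least 2 there, and \<open>2 * \<gamma>\<close> is at least
    \<open>\<gamma> * (1 + s)\<close>. One or two light vertices are completed to a triangle by
    heavy ones.\<close>
  consider "card S = 0" | "card S = 1" | "card S = 2" | "card S \<ge> 3" by linarith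
  then show ?thesis
  proof cases
    case 1
    then have "S = {}" using finS by simp
    then show ?thesis using reduce[of "{}"] by simp
  next
    case 2
    then obtain c where S: "S = {c}" by (auto simp: card_1_singleton_iff)
    then have "card (V - {c}) \<ge> 2"
      using assms SV by (simp add: card_Diff_subset)
    then obtain T where "T \<subseteq> V - {c}" "card T = 2"
      by (meson obtain_subset_with_card_n)
    then obtain a b where ab: "a \<in> V - {c}" "b \<in> V - {c}" "a \<noteq> b"
      by (auto simp: card_2_iff)
    have "c \<in> S" "a \<notin> S" "b \<notin> S" using S ab by auto
    then have c: "c \<in> V" "x c < 1" "0 < x c" and heavy: "1 \<le> x a" "1 \<le> x b"
      using ab pos unfolding S_def by auto
    have "(\<Prod>(u, v)\<in>edges {a, b, c}. m u v) = m b c * (m a b * m a c)"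
      using ab by (intro triple) auto
    \<comment> \<open>The edge between the two heavy vertices is bounded by 1, so each of them
      enters with exponent \<gamma> only, which is at most \<open>2 * s\<close>.\<close>
    also have "\<dots> \<le> (x b powr \<gamma> * x c powr \<gamma>) * (1 * (x a powr \<gamma> * x c powr \<gamma>))"
      using ab c m01 m_le1 by (intro mult_mono) auto
    also have "\<dots> = x a powr \<gamma> * (x b powr \<gamma> * x c powr (2 * \<gamma>))"
      unfolding powr_double by (simp only: mult_1_left mult_ac)
    also have "\<dots> \<le> f (x a) * (f (x b) * f (x c))"
      using f_heavy[OF heavy(1), of \<gamma>] f_heavy[OF heavy(2), of \<gamma>] f_light[of "x c" "2 * \<gamma>"]
        c s \<gamma> f0 by (intro mult_mono) auto
    also have "\<dots> = (\<Prod>v\<in>{a, b, c}. f (x v))"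
      using ab by simp
    finally have le: "(\<Prod>(u, v)\<in>edges {a, b, c}. m u v) \<le> (\<Prod>v\<in>{a, b, c}. f (x v))" .
    show ?thesis
      by (rule reduce[OF _ _ le]) (use ab c S in auto)
  next
    case 3
    then obtain b c where S: "S = {b, c}" "b \<noteq> c" by (auto simp: card_2_iff)
    have "card V \<le> card {b, c}" if "V \<subseteq> {b, c}"
      using that by (intro card_mono) auto
    then have "\<not> V \<subseteq> {b, c}"
      using assms(2) S(2) by auto
    then obtain a where a: "a \<in> V" "a \<noteq> b" "a \<noteq> c" by auto
    have "b \<in> S" "c \<in> S" "a \<notin> S" using S a by auto
    then have bc: "b \<in> V" "x b < 1" "0 < x b" "c \<in> V" "x c < 1" "0 < x c" and heavy: "1 \<le> x a"
      using a pos unfolding S_def by auto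
    have "(\<Prod>(u, v)\<in>edges {a, b, c}. m u v) = m b c * (m a b * m a c)"
      using a S by (intro triple) auto
    \<comment> \<open>The edge between the light vertices keeps its full exponent, while both edges
      at the heavy vertex \<open>a\<close> are weakened to \<open>s\<close>. Unweakened,
      \<open>a\<close> would get exponent \<open>2 * \<gamma>\<close>, which in the later
      application exceeds the tail exponent \<open>\<beta> - 1\<close>.\<close>
    also have "\<dots> \<le> (x b powr \<gamma> * x c powr \<gamma>) *
        ((x a powr (s * \<gamma>) * x b powr (s * \<gamma>)) * (x a powr (s * \<gamma>) * x c powr (s * \<gamma>)))"
      using a bc s m01 m_le1 m_le[of _ _ s] by (intro mult_mono) auto
    also have "\<dots> = x a powr (2 * s * \<gamma>) * (x b powr (\<gamma> * (1 + s)) * x c powr (\<gamma> * (1 + s)))"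
    proof -
      have "y powr (\<gamma> * (1 + s)) = y powr \<gamma> * y powr (s * \<gamma>)" for y
        by (simp only: powr_add[symmetric] distrib_left mult_1_right mult.commute[of s])
      then show ?thesis unfolding mult.assoc[of 2 s \<gamma>] powr_double by (simp only: mult_ac)
    qed
    also have "\<dots> \<le> f (x a) * (f (x b) * f (x c))"
    proof (intro mult_mono)
      have "2 * s * \<gamma> \<le> 2 * s * 1" using s \<gamma> by (intro mult_left_mono) auto
      then show "x a powr (2 * s * \<gamma>) \<le> f (x a)"
        using heavy by (intro f_heavy) auto
      show "x b powr (\<gamma> * (1 + s)) \<le> f (x b)" "x c powr (\<gamma> * (1 + s)) \<le> f (x c)"
        using bc by (auto intro!: f_light)
    qed (auto intro!: f0)
    also have "\<dots> = (\<Prod>v\<in>{a, b, c}. f (x v))"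
      using a S by simp
    finally have le: "(\<Prod>(u, v)\<in>edges {a, b, c}. m u v) \<le> (\<Prod>v\<in>{a, b, c}. f (x v))" .
    show ?thesis
      by (rule reduce[OF _ _ le]) (use a bc S in auto)
  next
    case 4
    have "(\<Prod>(u, v)\<in>edges S. m u v) \<le> (\<Prod>(u, v)\<in>edges S. x u powr \<gamma> * x v powr \<gamma>)"
    proof (rule prod_mono, clarify)
      fix u v assume "(u, v) \<in> edges S"
      then have "u \<in> V" "v \<in> V" using SV by (auto simp: edges_def)
      then show "0 \<le> m u v \<and> m u v \<le> x u powr \<gamma> * x v powr \<gamma>"
        using m01 m_le1 by auto
    qed
    also have "\<dots> = (\<Prod>v\<in>S. (x v powr \<gamma>) ^ (card S - 1))"
      by (rule prod_edges_mult[OF finS])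
    also have "\<dots> \<le> (\<Prod>v\<in>S. f (x v))"
    proof (intro prod_mono conjI)
      fix v assume "v \<in> S"
      then have v: "0 < x v" "x v \<le> 1" using pos by (auto simp: S_def)
      have "(x v powr \<gamma>) ^ (card S - 1) = x v powr (\<gamma> * real (card S - 1))"
        using v by (simp add: powr_powr flip: powr_realpow)
      also have "\<dots> \<le> f (x v)"
        using v 4 s \<gamma> by (intro f_light mult_left_mono) auto
      finally show "(x v powr \<gamma>) ^ (card S - 1) \<le> f (x v)" .
    qed auto
    finally have le: "(\<Prod>(u, v)\<in>edges S. m u v) \<le> (\<Prod>v\<in>S. f (x v))" .
    show ?thesis
      by (rule reduce[OF SV subset_refl le])
  qed
qed

section \<open>Integrating a two-sided power against a power-law tail\<close>

lemma suminf_ge_term: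
  fixes f :: "nat \<Rightarrow> ennreal"
  shows "f j \<le> suminf f"
  using sum_le_suminf[OF summableI, of "{j}" f] by simp

text \<open>Rounding \<open>t\<close> to a dyadic layer turns the power into a sum of tail
  indicators, so its integral can be estimated from tail bounds alone.\<close>

lemma two_powr_le_dyadic:
  fixes t A B :: real
  assumes "0 < t" "0 \<le> A" "0 \<le> B"
  shows "ennreal (two_powr A B t) \<le>
    (\<Sum>j. ennreal (2 powr (- real j * A)) * indicator {2 powr (- real j - 1)<..} t) +
    (\<Sum>j. ennreal (2 powr ((real j + 1) * B)) * indicator {2 powr real j<..} t)"
proof (cases "t \<le> 1")
  case True
  define j where "j = nat \<lfloor>- log 2 t\<rfloor>"
  have "log 2 t \<le> 0" using True assms by simp
  then have "real j = of_int \<lfloor>- log 2 t\<rfloor>" by (simp add: j_def)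
  then have j: "log 2 t \<le> - real j" "- real j - 1 < log 2 t"
    by linarith+
  have t: "t = 2 powr (log 2 t)" using assms by simp
  have 1: "2 powr (- real j - 1) < t"
    by (subst t) (use j in simp)
  have "two_powr A B t = 2 powr (log 2 t * A)"
    using True assms by (simp add: two_powr_def flip: powr_powr)
  also have "\<dots> \<le> 2 powr (- real j * A)"
    using j assms by (intro powr_mono mult_right_mono) auto
  finally have "ennreal (two_powr A B t) \<le>
      ennreal (2 powr (- real j * A)) * indicator {2 powr (- real j - 1)<..} t"
    using 1 by (simp add: ennreal_leI)
  also have "\<dots> \<le> (\<Sum>i. ennreal (2 powr (- real i * A)) * indicator {2 powr (- real i - 1)<..} t)"
    by (rule suminf_ge_term)
  finally show ?thesis by (rule add_increasing2[rotated]) simp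
next
  case False
  \<comment> \<open>Ceiling minus one: the layers \<open>2 powr j < t \<le> 2 powr (j + 1)\<close>
    are open on the left to match the strict tail indicators.\<close>
  define j where "j = nat (\<lceil>log 2 t\<rceil> - 1)"
  have "log 2 t > 0" using False by simp
  then have "real j = of_int \<lceil>log 2 t\<rceil> - 1" unfolding j_def by (subst of_nat_nat) (auto simp: le_ceiling_iff)
  then have j: "log 2 t \<le> real j + 1" "real j < log 2 t"
    by linarith+
  have t: "t = 2 powr (log 2 t)" using assms by simp
  have 1: "2 powr real j < t"
    by (subst t) (use j in simp)
  have "two_powr A B t = 2 powr (log 2 t * B)"
    using False assms by (simp add: two_powr_def flip: powr_powr)
  also have "\<dots> \<le> 2 powr ((real j + 1) * B)"
    using j assms by (intro powr_mono mult_right_mono) auto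
  finally have "ennreal (two_powr A B t) \<le>
      ennreal (2 powr ((real j + 1) * B)) * indicator {2 powr real j<..} t"
    using 1 by (simp add: ennreal_leI)
  also have "\<dots> \<le> (\<Sum>i. ennreal (2 powr ((real i + 1) * B)) * indicator {2 powr real i<..} t)"
    by (rule suminf_ge_term)
  finally show ?thesis by (rule add_increasing[rotated]) simp
qed

text \<open>The light and heavy layers give geometric series with ratios
  \<open>2 powr (\<alpha> - A)\<close> and \<open>2 powr (B - \<alpha>)\<close>, both below 1. The
  tail constant \<open>K\<close> factors out, so a dependence on the number of vertices can sit
  entirely in \<open>K\<close>.\<close>

lemma nn_integral_two_powr_le:
  fixes X :: "'a \<Rightarrow> real" and A B \<alpha> K :: real
  assumes [measurable]: "X \<in> borel_measurable M" and pos: "AE y in M. 0 < X y"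
    and tail: "\<And>t. 0 < t \<Longrightarrow> emeasure M {y \<in> space M. t < X y} \<le> ennreal (K * t powr (- \<alpha>))"
    and "0 \<le> B" "B < \<alpha>" "\<alpha> < A" "0 \<le> K"
  shows "(\<integral>\<^sup>+y. ennreal (two_powr A B (X y)) \<partial>M) \<le>
    ennreal (K * (2 powr \<alpha> / (1 - 2 powr (\<alpha> - A)) + 2 powr B / (1 - 2 powr (B - \<alpha>))))"
proof -
  have geo: "(\<Sum>j. ennreal (K * c * (2 powr p) ^ j)) = ennreal (K * (c / (1 - 2 powr p)))"
    if "p < 0" "0 \<le> c" for c p :: real
  proof -
    have lt1: "2 powr p < 1"
      using that powr_less_mono[of p 0 2] by simp
    then have "(\<lambda>j. (2 powr p) ^ j) sums (1 / (1 - 2 powr p))"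
      by (intro geometric_sums) auto
    from sums_mult[OF this, of "K * c"] show ?thesis
      using that \<open>0 \<le> K\<close> lt1
      by (intro sums_unique[symmetric] sums_ennreal[THEN iffD2]) (auto intro!: divide_nonneg_pos)
  qed
  have ind: "(\<integral>\<^sup>+y. ennreal c * indicator {t<..} (X y) \<partial>M) \<le> ennreal (K * (c * t powr (- \<alpha>)))"
    if "0 < t" "0 \<le> c" for c t
  proof -
    have "(\<integral>\<^sup>+y. ennreal c * indicator {t<..} (X y) \<partial>M) =
        (\<integral>\<^sup>+y. ennreal c * indicator {y \<in> space M. t < X y} y \<partial>M)"
      by (intro nn_integral_cong) (auto simp: indicator_def)
    also have "\<dots> = ennreal c * emeasure M {y \<in> space M. t < X y}"
      by (rule nn_integral_cmult_indicator) measurable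
    also have "\<dots> \<le> ennreal c * ennreal (K * t powr (- \<alpha>))"
      using tail[OF that(1)] by (intro mult_left_mono) auto
    also have "\<dots> = ennreal (K * (c * t powr (- \<alpha>)))"
      using that assms by (simp add: ennreal_mult'[symmetric] mult_ac)
    finally show ?thesis .
  qed
  have "(\<integral>\<^sup>+y. ennreal (two_powr A B (X y)) \<partial>M) \<le> (\<integral>\<^sup>+y.
      (\<Sum>j. ennreal (2 powr (- real j * A)) * indicator {2 powr (- real j - 1)<..} (X y)) +
      (\<Sum>j. ennreal (2 powr ((real j + 1) * B)) * indicator {2 powr real j<..} (X y)) \<partial>M)"
    using pos
  proof (intro nn_integral_mono_AE, eventually_elim)
    case (elim y)
    show ?case using elim assms(4-7) by (intro two_powr_le_dyadic) auto
  qed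
  also have "\<dots> =
      (\<Sum>j. \<integral>\<^sup>+y. ennreal (2 powr (- real j * A)) * indicator {2 powr (- real j - 1)<..} (X y) \<partial>M) +
      (\<Sum>j. \<integral>\<^sup>+y. ennreal (2 powr ((real j + 1) * B)) * indicator {2 powr real j<..} (X y) \<partial>M)"
    by (subst nn_integral_add, measurable, subst (1 2) nn_integral_suminf) auto
  also have "\<dots> \<le> (\<Sum>j. ennreal (K * 2 powr \<alpha> * (2 powr (\<alpha> - A)) ^ j)) +
      (\<Sum>j. ennreal (K * 2 powr B * (2 powr (B - \<alpha>)) ^ j))"
  proof (intro add_mono suminf_le summableI)
    fix j
    have "2 powr (- real j * A) * (2 powr (- real j - 1)) powr (- \<alpha>) = 2 powr \<alpha> * (2 powr (\<alpha> - A)) ^ j"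
      by (simp add: powr_powr powr_add[symmetric] algebra_simps flip: powr_realpow)
    then show "(\<integral>\<^sup>+y. ennreal (2 powr (- real j * A)) * indicator {2 powr (- real j - 1)<..} (X y) \<partial>M)
        \<le> ennreal (K * 2 powr \<alpha> * (2 powr (\<alpha> - A)) ^ j)"
      using ind[of "2 powr (- real j - 1)" "2 powr (- real j * A)"] by (simp add: mult.assoc)
    have "2 powr ((real j + 1) * B) * (2 powr real j) powr (- \<alpha>) = 2 powr B * (2 powr (B - \<alpha>)) ^ j"
      by (simp add: powr_powr powr_add[symmetric] algebra_simps flip: powr_realpow)
    then show "(\<integral>\<^sup>+y. ennreal (2 powr ((real j + 1) * B)) * indicator {2 powr real j<..} (X y) \<partial>M)
        \<le> ennreal (K * 2 powr B * (2 powr (B - \<alpha>)) ^ j)"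
      using ind[of "2 powr real j" "2 powr ((real j + 1) * B)"] by (simp add: mult.assoc)
  qed
  also have "\<dots> = ennreal (K * (2 powr \<alpha> / (1 - 2 powr (\<alpha> - A))) + K * (2 powr B / (1 - 2 powr (B - \<alpha>))))"
  proof -
    have "2 powr (\<alpha> - A) < 1" "2 powr (B - \<alpha>) < 1"
      using assms powr_less_mono[of "\<alpha> - A" 0 2] powr_less_mono[of "B - \<alpha>" 0 2] by simp_all
    then show ?thesis
      using assms by (subst (1 2) geo) (auto intro!: ennreal_plus[symmetric])
  qed
  finally show ?thesis by (simp add: distrib_left)
qed

section \<open>Clique events\<close>

locale girg =
  fixes lam w0 \<beta> :: real and n d :: nat
  assumes lam_pos: "lam > 0" and w0_pos: "w0 > 0" and \<beta>_gt: "\<beta> > 2"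
    and n_pos: "n > 0" and d_pos: "d > 0"
begin

abbreviation W :: "real measure" where
  "W \<equiv> weight_measure \<beta> w0"

abbreviation Q :: "nat set \<Rightarrow> girg_outcome measure" where
  "Q V \<equiv> \<Pi>\<^sub>M v\<in>V. W \<Otimes>\<^sub>M torus_measure d"

abbreviation radius :: "real \<Rightarrow> real \<Rightarrow> real" where
  "radius a b \<equiv> 1 / 2 * (lam * a * b / real n) powr (1 / real d)"

text \<open>\<open>V\<close> carries the sample and \<open>S\<close> is tested; keeping them apart
  allows passing from the whole graph to the marginal law on \<open>S\<close>.\<close>

definition clique_event :: "nat set \<Rightarrow> nat set \<Rightarrow> girg_outcome set" where
  "clique_event V S = {G \<in> space (Q V). pairwise (girg_adj lam n d G) S}"

section \<open>The vertex law, the weight tail and adjacency\<close>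

lemma prob_space_W: "prob_space W"
  using prob_space_weight_measure w0_pos \<beta>_gt by simp

lemma sets_W [measurable_cong]: "sets W = sets borel"
  by (simp add: weight_measure_def)

lemma space_W: "space W = UNIV"
  using sets_eq_imp_space_eq[OF sets_W] by simp

lemma prob_space_WT: "prob_space (W \<Otimes>\<^sub>M torus_measure d)"
proof -
  interpret W: prob_space W by (rule prob_space_W)
  interpret T: prob_space "torus_measure d" by (rule prob_space_torus_measure)
  interpret pair_prob_space W "torus_measure d" ..
  show ?thesis by unfold_locales
qed

lemma prob_space_Q: "prob_space (Q V)"
  by (intro prob_space_PiM prob_space_WT)

lemma product_prob_space_WT: "product_prob_space (\<lambda>_. W \<Otimes>\<^sub>M torus_measure d)"
  using prob_space_WT by (simp add: product_prob_space_def product_prob_space_axioms_def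
        product_sigma_finite_def prob_space_imp_sigma_finite)

lemma girg_measure_eq: "girg_measure n \<beta> w0 d = Q {..<n}"
  by (simp add: girg_measure_def)

lemma measure_W_greaterThan:
  assumes "w0 \<le> y"
  shows "measure W {y<..} = (y / w0) powr (1 - \<beta>)"
proof -
  interpret W: prob_space W by (rule prob_space_W)
  have "measure W {y<..} = 1 - measure W {..y}"
    using W.prob_compl[of "{..y}"] by (simp add: space_W sets_W Compl_eq_Diff_UNIV[symmetric])
  then show ?thesis
    using measure_weight_measure_Iic[of w0 \<beta> y] assms w0_pos \<beta>_gt by simp
qed

text \<open>Below \<open>w0\<close> the Pareto expression is at least 1, so one power bound covers
  every positive threshold.\<close>

lemma emeasure_W_greaterThan_le:
  assumes "0 < y"
  shows "emeasure W {y<..} \<le> ennreal ((y / w0) powr (1 - \<beta>))"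
proof (cases "w0 \<le> y")
  case True
  interpret W: prob_space W by (rule prob_space_W)
  show ?thesis
    using measure_W_greaterThan[OF True] by (simp add: W.emeasure_eq_measure)
next
  case False
  interpret W: prob_space W by (rule prob_space_W)
  have "1 = (1::real) powr (1 - \<beta>)" by simp
  also have "\<dots> \<le> (y / w0) powr (1 - \<beta>)"
    using False assms w0_pos \<beta>_gt by (intro powr_mono2') auto
  finally have "ennreal 1 \<le> ennreal ((y / w0) powr (1 - \<beta>))"
    by (rule ennreal_leI)
  with W.emeasure_le_1[of "{y<..}"] show ?thesis
    unfolding ennreal_1 by (rule order_trans)
qed

lemma AE_W_ge: "AE w in W. w0 \<le> w"
proof -
  interpret W: prob_space W by (rule prob_space_W)
  have "measure W {..w0} = 0"
    using measure_weight_measure_Iic[of w0 \<beta> w0] w0_pos \<beta>_gt by simp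
  then have "AE w in W. w \<notin> {..w0}"
    by (subst W.prob_eq_0[symmetric]) (auto simp: sets_W space_W)
  then show ?thesis by eventually_elim auto
qed

lemma torus_dist_le_iff: "torus_dist d x y \<le> t \<longleftrightarrow> (\<forall>i<d. circle_dist (x i) (y i) \<le> t)"
  unfolding torus_dist_def using d_pos by (subst Max_le_iff) auto

lemma pairwise_girg_adj_iff:
  "pairwise (girg_adj lam n d G) V \<longleftrightarrow> (\<forall>(u, v)\<in>edges V. \<forall>i<d.
     circle_dist (snd (G u) i) (snd (G v) i) \<le> radius (fst (G u)) (fst (G v)))"
proof -
  define P where "P u v \<longleftrightarrow> (\<forall>i<d. circle_dist (snd (G u) i) (snd (G v) i)
      \<le> radius (fst (G u)) (fst (G v)))" for u v
  have sym: "P u v \<longleftrightarrow> P v u" for u v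
    by (simp add: P_def circle_dist_commute mult_ac)
  have "girg_adj lam n d G u v \<longleftrightarrow> u \<noteq> v \<and> P u v" for u v
    by (simp only: girg_adj_def P_def torus_dist_le_iff)
  then have "pairwise (girg_adj lam n d G) V \<longleftrightarrow> (\<forall>u\<in>V. \<forall>v\<in>V. u \<noteq> v \<longrightarrow> P u v)"
    by (auto simp: pairwise_def)
  also have "\<dots> \<longleftrightarrow> (\<forall>(u, v)\<in>edges V. P u v)"
    using sym by (auto simp: edges_def) (metis linorder_neq_iff)
  finally show ?thesis by (simp add: P_def)
qed

text \<open>Two such weights have product at least \<open>n / lam\<close>, so the radius is at least
  1 / 2, the largest possible distance on the circle.\<close>

lemma pairwise_girg_adj_heavy:
  assumes "\<And>v. v \<in> V \<Longrightarrow> sqrt (real n / lam) \<le> fst (G v)"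
  shows "pairwise (girg_adj lam n d G) V"
  unfolding pairwise_girg_adj_iff
proof clarify
  fix u v i assume uv: "(u, v) \<in> edges V"
  then have "u \<in> V" "v \<in> V" by (auto simp: edges_def)
  then have "sqrt (real n / lam) \<le> fst (G u)" "sqrt (real n / lam) \<le> fst (G v)"
    using assms by auto
  moreover have "0 \<le> sqrt (real n / lam)"
    using lam_pos by simp
  ultimately have "sqrt (real n / lam) * sqrt (real n / lam) \<le> fst (G u) * fst (G v)"
    by (intro mult_mono) linarith+
  then have "1 \<le> lam * fst (G u) * fst (G v) / real n"
    using lam_pos n_pos by (simp add: field_simps)
  then have "1 \<le> (lam * fst (G u) * fst (G v) / real n) powr (1 / real d)"
    by (intro ge_one_powr_ge_zero) auto
  then show "circle_dist (snd (G u) i) (snd (G v) i) \<le> radius (fst (G u)) (fst (G v))"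
    using circle_dist_le_half[of "snd (G u) i" "snd (G v) i"] by linarith
qed

section \<open>Measurability, marginals and independence of clique events\<close>

lemma sets_clique_event:
  assumes "finite V" "S \<subseteq> V"
  shows "clique_event V S \<in> sets (Q V)"
proof -
  have "{G \<in> space (Q V). \<forall>e\<in>edges S. \<forall>i\<in>{..<d}. circle_dist (snd (G (fst e)) i) (snd (G (snd e)) i)
      \<le> radius (fst (G (fst e))) (fst (G (snd e)))} \<in> sets (Q V)"
  proof (intro sets.sets_Collect_finite_All)
    fix e i assume "e \<in> edges S" "i \<in> {..<d}"
    then have uv: "fst e \<in> V" "snd e \<in> V" and i: "i \<in> {..<d}"
      using assms by (auto simp: edges_def)
    have coord: "(\<lambda>G. snd (G v) i) \<in> borel_measurable (Q V)" if "v \<in> V" for v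
    proof -
      have "(\<lambda>x. x i) \<in> measurable (torus_measure d) unif"
        unfolding torus_measure_def using i by (rule measurable_component_singleton)
      then have "(\<lambda>x. x i) \<in> borel_measurable (torus_measure d)"
        by (simp add: measurable_cong_sets[OF refl sets_uniform_measure])
      moreover have "(\<lambda>G. snd (G v)) \<in> measurable (Q V) (torus_measure d)"
        using that by measurable
      ultimately show ?thesis by (rule measurable_compose[rotated])
    qed
    have weight: "(\<lambda>G. fst (G v)) \<in> borel_measurable (Q V)" if "v \<in> V" for v
    proof -
      have "(\<lambda>G. fst (G v)) \<in> measurable (Q V) W"
        using that by measurable
      then show ?thesis by (simp add: measurable_cong_sets[OF refl sets_W])
    qed
    note coord[OF uv(1), measurable] coord[OF uv(2), measurable]
      weight[OF uv(1), measurable] weight[OF uv(2), measurable]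
    show "{G \<in> space (Q V). circle_dist (snd (G (fst e)) i) (snd (G (snd e)) i)
      \<le> radius (fst (G (fst e))) (fst (G (snd e)))} \<in> sets (Q V)"
      by measurable
  qed (use assms finite_subset[OF assms(2,1)] in \<open>auto intro: finite_edges\<close>)
  also have "{G \<in> space (Q V). \<forall>e\<in>edges S. \<forall>i\<in>{..<d}. circle_dist (snd (G (fst e)) i) (snd (G (snd e)) i)
      \<le> radius (fst (G (fst e))) (fst (G (snd e)))} = clique_event V S"
    by (simp add: clique_event_def pairwise_girg_adj_iff split_beta Ball_def)
  finally show ?thesis .
qed

lemma measure_clique_event_restrict:
  assumes "finite V" "S \<subseteq> V"
  shows "measure (Q V) (clique_event V S) = measure (Q S) (clique_event S S)"
proof -
  interpret product_prob_space "\<lambda>_::nat. W \<Otimes>\<^sub>M torus_measure d" V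
    by (rule product_prob_space_WT)
  have finS: "finite S" using assms finite_subset by blast
  have meas: "(\<lambda>f. restrict f S) \<in> measurable (Q V) (Q S)"
    using assms by (intro measurable_restrict_subset)
  have "measure (Q S) (clique_event S S) =
      measure (distr (Q V) (Q S) (\<lambda>f. restrict f S)) (clique_event S S)"
    using distr_restrict[OF assms(2,1)] by simp
  also have "\<dots> = measure (Q V) ((\<lambda>f. restrict f S) -` clique_event S S \<inter> space (Q V))"
    using meas sets_clique_event[OF finS subset_refl] by (rule measure_distr)
  also have "(\<lambda>f. restrict f S) -` clique_event S S \<inter> space (Q V) = clique_event V S"
  proof -
    have "pairwise (girg_adj lam n d (restrict G S)) S \<longleftrightarrow> pairwise (girg_adj lam n d G) S" for G
      by (auto simp: pairwise_def girg_adj_def)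
    then show ?thesis
      using measurable_space[OF meas] by (auto simp: clique_event_def)
  qed
  finally show ?thesis by simp
qed

text \<open>Forgetting the edges between \<open>S\<close> and \<open>T\<close> leaves two events on
  disjoint sets of independent vertices.\<close>

lemma measure_clique_event_Un_le:
  assumes "finite S" "finite T" "S \<inter> T = {}"
  shows "measure (Q (S \<union> T)) (clique_event (S \<union> T) (S \<union> T))
    \<le> measure (Q S) (clique_event S S) * measure (Q T) (clique_event T T)"
proof -
  interpret product_prob_space "\<lambda>_::nat. W \<Otimes>\<^sub>M torus_measure d" S
    by (rule product_prob_space_WT)
  interpret S: prob_space "Q S" by (rule prob_space_Q)
  interpret T: prob_space "Q T" by (rule prob_space_Q)
  interpret ST: pair_prob_space "Q S" "Q T" ..
  let ?E = "clique_event (S \<union> T) (S \<union> T)"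
  have meas: "merge S T \<in> measurable (Q S \<Otimes>\<^sub>M Q T) (Q (S \<union> T))"
    by (rule measurable_merge)
  have setsE: "?E \<in> sets (Q (S \<union> T))"
    using assms by (intro sets_clique_event) auto
  have "measure (Q (S \<union> T)) ?E =
      measure (distr (Q S \<Otimes>\<^sub>M Q T) (Q (S \<union> T)) (merge S T)) ?E"
    using distr_merge[OF assms(3,1,2)] by simp
  also have "\<dots> = measure (Q S \<Otimes>\<^sub>M Q T) (merge S T -` ?E \<inter> space (Q S \<Otimes>\<^sub>M Q T))"
    using meas setsE by (rule measure_distr)
  also have "\<dots> \<le> measure (Q S \<Otimes>\<^sub>M Q T) (clique_event S S \<times> clique_event T T)"
  proof (rule ST.finite_measure_mono)
    show "clique_event S S \<times> clique_event T T \<in> sets (Q S \<Otimes>\<^sub>M Q T)"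
      using assms by (intro pair_measureI sets_clique_event) auto
    show "merge S T -` ?E \<inter> space (Q S \<Otimes>\<^sub>M Q T) \<subseteq> clique_event S S \<times> clique_event T T"
    proof clarify
      fix f g assume *: "merge S T (f, g) \<in> ?E" "(f, g) \<in> space (Q S \<Otimes>\<^sub>M Q T)"
      let ?G = "merge S T (f, g)"
      have adj: "girg_adj lam n d ?G u v" if "u \<in> S \<union> T" "v \<in> S \<union> T" "u \<noteq> v" for u v
        using * that by (auto simp: clique_event_def pairwise_def)
      have S: "?G v = f v" if "v \<in> S" for v using that by (simp add: merge_def)
      have T: "?G v = g v" if "v \<in> T" for v using that assms by (auto simp: merge_def)
      have "girg_adj lam n d f u v" if "u \<in> S" "v \<in> S" "u \<noteq> v" for u v
        using adj[of u v] that S by (simp add: girg_adj_def)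
      moreover have "girg_adj lam n d g u v" if "u \<in> T" "v \<in> T" "u \<noteq> v" for u v
        using adj[of u v] that T by (simp add: girg_adj_def)
      ultimately show "f \<in> clique_event S S \<and> g \<in> clique_event T T"
        using *(2) by (auto simp: clique_event_def pairwise_def space_pair_measure)
    qed
  qed
  also have "\<dots> = measure (Q S) (clique_event S S) * measure (Q T) (clique_event T T)"
    using sets_clique_event[OF assms(1) subset_refl] sets_clique_event[OF assms(2) subset_refl]
    by (simp add: measure_def T.emeasure_pair_measure_Times enn2real_mult)
  finally show ?thesis .
qed

text \<open>The estimate for small sets has a bounded number of edges and thus one \<gamma> for all
  of them. Peeling off triples extends it to all sizes with the same \<open>b\<close>, which makes
  the final constants independent of the clique size.\<close>

lemma measure_clique_event_le_power:
  assumes small: "\<And>V. finite V \<Longrightarrow> 3 \<le> card V \<Longrightarrow> card V \<le> 5 \<Longrightarrow>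
      measure (Q V) (clique_event V V) \<le> b ^ card V"
    and "0 \<le> b" "finite V" "3 \<le> card V"
  shows "measure (Q V) (clique_event V V) \<le> b ^ card V"
  using assms(3,4)
proof (induction "card V" arbitrary: V rule: less_induct)
  case less
  show ?case
  proof (cases "card V \<le> 5")
    case True
    then show ?thesis using less small by blast
  next
    case False
    \<comment> \<open>At least six vertices are present, so at least three remain and the induction
      hypothesis applies. This is why 3, 4 and 5 are the base cases.\<close>
    then obtain T where T: "T \<subseteq> V" "card T = 3"
      by (meson less.prems(2) obtain_subset_with_card_n)
    then have finT: "finite T" using less.prems finite_subset by blast
    have card: "card (V - T) = card V - 3"
      using T finT by (simp add: card_Diff_subset)
    have V: "V = T \<union> (V - T)" using T by auto
    have "measure (Q V) (clique_event V V) \<le>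
        measure (Q T) (clique_event T T) * measure (Q (V - T)) (clique_event (V - T) (V - T))"
      using measure_clique_event_Un_le[of T "V - T"] finT less.prems V by simp
    also have "\<dots> \<le> b ^ card T * b ^ card (V - T)"
    proof (intro mult_mono)
      show "measure (Q T) (clique_event T T) \<le> b ^ card T"
        using T finT by (intro small) auto
      show "measure (Q (V - T)) (clique_event (V - T) (V - T)) \<le> b ^ card (V - T)"
        using False less.prems card by (intro less.hyps) auto
    qed (use \<open>0 \<le> b\<close> in auto)
    also have "\<dots> = b ^ card V"
      using False T card by (simp flip: power_add)
    finally show ?thesis .
  qed
qed

section \<open>Bounds for fixed parameters\<close>

text \<open>After scaling by \<open>c = sqrt (lam / n)\<close> the tail constant is
  \<open>(w0 * c) powr (\<beta> - 1)\<close>, which carries the whole dependence on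
  \<open>n\<close>.\<close>

lemma nn_integral_W_two_powr_le:
  assumes "0 \<le> B" "B < \<beta> - 1" "\<beta> - 1 < A"
  shows "(\<integral>\<^sup>+w. ennreal (two_powr A B (sqrt (lam / real n) * w)) \<partial>W) \<le>
    ennreal ((2 powr (\<beta> - 1) / (1 - 2 powr (\<beta> - 1 - A)) + 2 powr B / (1 - 2 powr (B - (\<beta> - 1)))) *
      (w0 * sqrt lam) powr (\<beta> - 1) * real n powr (- (\<beta> - 1) / 2))"
proof -
  define c where "c = sqrt (lam / real n)"
  have c: "0 < c" using lam_pos n_pos by (simp add: c_def)
  have tail: "emeasure W {w \<in> space W. t < c * w} \<le> ennreal ((w0 * c) powr (\<beta> - 1) * t powr (- (\<beta> - 1)))"
    if t: "0 < t" for t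
  proof -
    have "{w \<in> space W. t < c * w} = {t / c<..}"
      using c by (auto simp: space_W field_simps)
    moreover have "(t / c / w0) powr (1 - \<beta>) = (w0 * c) powr (\<beta> - 1) * t powr (- (\<beta> - 1))"
    proof -
      have "(t / c / w0) powr (1 - \<beta>) = (t / (w0 * c)) powr (1 - \<beta>)"
        by (simp add: mult.commute)
      also have "\<dots> = t powr (1 - \<beta>) / (w0 * c) powr (1 - \<beta>)"
        by (rule powr_divide)
      also have "\<dots> = (w0 * c) powr (- (1 - \<beta>)) * t powr (1 - \<beta>)"
        by (simp only: powr_minus divide_inverse mult.commute)
      finally show ?thesis by simp
    qed
    ultimately show ?thesis
      using emeasure_W_greaterThan_le[of "t / c"] t c by simp
  qed
  have "AE w in W. 0 < c * w"
    using AE_W_ge c w0_pos by (auto elim!: eventually_mono)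
  from nn_integral_two_powr_le[OF _ this tail assms]
  have "(\<integral>\<^sup>+w. ennreal (two_powr A B (c * w)) \<partial>W) \<le> ennreal ((w0 * c) powr (\<beta> - 1) *
    (2 powr (\<beta> - 1) / (1 - 2 powr (\<beta> - 1 - A)) + 2 powr B / (1 - 2 powr (B - (\<beta> - 1)))))"
    by simp
  moreover have "(w0 * c) powr (\<beta> - 1) = (w0 * sqrt lam) powr (\<beta> - 1) * real n powr (- (\<beta> - 1) / 2)"
  proof -
    have "w0 * c = (w0 * sqrt lam) * real n powr (- 1 / 2)"
      using n_pos lam_pos
      by (simp add: c_def real_sqrt_divide powr_minus_divide powr_half_sqrt divide_simps)
    then have "(w0 * c) powr (\<beta> - 1) =
        (w0 * sqrt lam) powr (\<beta> - 1) * (real n powr (- 1 / 2)) powr (\<beta> - 1)"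
      using w0_pos lam_pos by (simp add: powr_mult)
    moreover have "- 1 / 2 * (\<beta> - 1) = - (\<beta> - 1) / 2" by (simp add: field_simps)
    ultimately show ?thesis by (simp only: powr_powr)
  qed
  ultimately show ?thesis
    by (simp add: c_def mult_ac)
qed

text \<open>Given the weights, each coordinate contributes \<open>q e powr \<gamma>\<close> per edge
  with \<open>q e = p powr (1 / d)\<close>; the \<open>d\<close>-th power cancels the root and
  leaves \<open>p powr \<gamma>\<close>. The bound by a product over vertices then factorises the
  integral over the independent weights.\<close>

lemma measure_clique_event_small_le:
  fixes s \<gamma> \<epsilon>0 C :: real
  assumes V: "finite V" "3 \<le> card V" "card V \<le> 5"
    and s: "1 / 2 \<le> s" "s \<le> 1" "2 * s < \<beta> - 1"
    and \<gamma>: "0 < \<gamma>" "\<gamma> \<le> 1" "\<beta> - 1 < \<gamma> * (1 + s)" "\<gamma> \<le> (1 - 25 * \<epsilon>0) * (1 - \<epsilon>0)"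
    and \<epsilon>0: "0 \<le> \<epsilon>0" "\<epsilon>0 < 1" "1 - \<epsilon>0 \<le> min 1 (lam * w0\<^sup>2 / real n) powr (1 / real d)"
    and C: "C = 2 powr (\<beta> - 1) / (1 - 2 powr (\<beta> - 1 - \<gamma> * (1 + s))) +
       2 powr (2 * s) / (1 - 2 powr (2 * s - (\<beta> - 1)))"
  shows "measure (Q V) (clique_event V V) \<le>
    (C * (w0 * sqrt lam) powr (\<beta> - 1) * real n powr (- (\<beta> - 1) / 2)) ^ card V"
proof -
  define c where "c = sqrt (lam / real n)"
  define b where "b = C * (w0 * sqrt lam) powr (\<beta> - 1) * real n powr (- (\<beta> - 1) / 2)"
  define f where "f = two_powr (\<gamma> * (1 + s)) (2 * s)"
  have c: "0 < c" "c * c = lam / real n"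
    using lam_pos n_pos by (simp_all add: c_def)
  have "2 powr (\<beta> - 1 - \<gamma> * (1 + s)) < 1" "2 powr (2 * s - (\<beta> - 1)) < 1"
    using s \<gamma> powr_less_mono[of "\<beta> - 1 - \<gamma> * (1 + s)" 0 2] powr_less_mono[of "2 * s - (\<beta> - 1)" 0 2]
    by simp_all
  then have b0: "0 \<le> b"
    by (auto simp: b_def C intro!: mult_nonneg_nonneg add_nonneg_nonneg)
  interpret W: prob_space W by (rule prob_space_W)
  interpret PW: product_prob_space "\<lambda>_::nat. W" V
    by unfold_locales
  interpret Q: prob_space "Q V" by (rule prob_space_Q)
  interpret U: prob_space "\<Pi>\<^sub>M v\<in>V. unif" by (intro prob_space_PiM prob_space_unif)
  \<comment> \<open>The crude count of all pairs from five vertices suffices and explains the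
    constant 25 in the condition on \<gamma>.\<close>
  have card_edges: "real (card (edges V)) \<le> 25"
  proof -
    have "card (edges V) \<le> card (V \<times> V)"
      using V by (intro card_mono) (auto simp: edges_def)
    also have "\<dots> \<le> 5 * 5"
      unfolding card_cartesian_product using V by (intro mult_mono) auto
    finally show ?thesis by simp
  qed
  have pointwise: "emeasure (\<Pi>\<^sub>M v\<in>V. unif) {x \<in> space (\<Pi>\<^sub>M v\<in>V. unif).
        \<forall>(u, v)\<in>edges V. circle_dist (x u) (x v) \<le> radius (y u) (y v)} ^ d
      \<le> (\<Prod>v\<in>V. ennreal (f (c * y v)))"
    if y: "\<And>v. v \<in> V \<Longrightarrow> w0 \<le> y v" for y
  proof -
    define p where "p u v = min 1 ((c * y u) * (c * y v))" for u v
    define q where "q e = p (fst e) (snd e) powr (1 / real d)" for e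
    have xx: "(c * y u) * (c * y v) = lam * y u * y v / real n" for u v
    proof -
      have "(c * y u) * (c * y v) = (c * c) * y u * y v" by (simp only: mult_ac)
      then show ?thesis by (simp add: c(2))
    qed
    \<comment> \<open>Two vertices of minimal weight \<open>w0\<close> are the least likely to be
      adjacent, so \<open>\<epsilon>0\<close> bounds the failure probability of every edge in one
      coordinate.\<close>
    have p: "min 1 (lam * w0\<^sup>2 / real n) \<le> p u v" "p u v \<le> 1" if "u \<in> V" "v \<in> V" for u v
    proof -
      have "w0 * w0 \<le> y u * y v"
        using y[OF that(1)] y[OF that(2)] w0_pos by (intro mult_mono) auto
      then have "lam * (w0 * w0) / real n \<le> lam * (y u * y v) / real n"
        using lam_pos by (intro divide_right_mono mult_left_mono) auto
      then show "min 1 (lam * w0\<^sup>2 / real n) \<le> p u v"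
        unfolding p_def xx by (auto simp: power2_eq_square mult_ac min_def)
      show "p u v \<le> 1" by (simp add: p_def)
    qed
    have p0: "0 < min 1 (lam * w0\<^sup>2 / real n)"
      using lam_pos w0_pos n_pos by simp
    have q: "1 - \<epsilon>0 \<le> q e" "q e \<le> 1" if "e \<in> edges V" for e
    proof -
      have uv: "fst e \<in> V" "snd e \<in> V" using that by (auto simp: edges_def)
      have "min 1 (lam * w0\<^sup>2 / real n) powr (1 / real d) \<le> q e"
        unfolding q_def using p(1)[OF uv] p0 by (intro powr_mono2) auto
      then show "1 - \<epsilon>0 \<le> q e" using \<epsilon>0 by linarith
      show "q e \<le> 1"
        unfolding q_def using p[OF uv] p0 by (intro powr_le1) auto
    qed
    \<comment> \<open>Capping the radius at 1 / 2 changes nothing, since circle distances never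
      exceed 1 / 2.\<close>
    have le_iff: "t \<le> radius (y u) (y v) \<longleftrightarrow> t \<le> q (u, v) / 2" if "t \<le> 1 / 2" for t u v
    proof (cases "lam * y u * y v / real n \<le> 1")
      case True
      then show ?thesis by (simp add: q_def p_def xx)
    next
      case False
      then have "1 \<le> (lam * y u * y v / real n) powr (1 / real d)"
        by (intro ge_one_powr_ge_zero) auto
      moreover have "q (u, v) = 1"
        using False by (simp add: q_def p_def xx)
      ultimately show ?thesis using that by auto
    qed
    have "{x \<in> space (\<Pi>\<^sub>M v\<in>V. unif). \<forall>(u, v)\<in>edges V. circle_dist (x u) (x v) \<le> radius (y u) (y v)} =
        {x \<in> space (\<Pi>\<^sub>M v\<in>V. unif). \<forall>(u, v)\<in>edges V. circle_dist (x u) (x v) \<le> q (u, v) / 2}"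
      (is "?A = ?A'")
      by (simp only: le_iff[OF circle_dist_le_half])
    then have "measure (\<Pi>\<^sub>M v\<in>V. unif) ?A \<le> (\<Prod>e\<in>edges V. q e powr \<gamma>)"
      using prob_coordinate_clique_le[OF V(1) q \<epsilon>0(1,2) card_edges less_imp_le[OF \<gamma>(1)] \<gamma>(4)] by simp
    then have "measure (\<Pi>\<^sub>M v\<in>V. unif) ?A ^ d \<le> (\<Prod>e\<in>edges V. q e powr \<gamma>) ^ d"
      by (intro power_mono) auto
    also have "\<dots> = (\<Prod>(u, v)\<in>edges V. p u v powr \<gamma>)"
      unfolding prod_power_distrib
    proof (intro prod.cong refl)
      fix e assume "e \<in> edges V"
      then have "0 < q e" using q(1)[of e] \<epsilon>0 by linarith
      then have "(q e powr \<gamma>) ^ d = q e powr (\<gamma> * real d)"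
        by (simp add: powr_powr flip: powr_realpow)
      also have "\<dots> = p (fst e) (snd e) powr \<gamma>"
        using d_pos by (simp add: q_def powr_powr)
      finally show "(q e powr \<gamma>) ^ d = (case e of (u, v) \<Rightarrow> p u v powr \<gamma>)"
        by (simp add: split_beta)
    qed
    also have "\<dots> \<le> (\<Prod>v\<in>V. f (c * y v))"
      unfolding p_def f_def
    proof (rule prod_edges_le_prod_two_powr)
      fix v assume "v \<in> V"
      then have "0 < y v" using y[of v] w0_pos by linarith
      then show "0 < c * y v" using c by simp
    qed (use V s \<gamma> in auto)
    finally have "ennreal (measure (\<Pi>\<^sub>M v\<in>V. unif) ?A ^ d) \<le> ennreal (\<Prod>v\<in>V. f (c * y v))"
      by (rule ennreal_leI)
    moreover have "0 \<le> f t" for t by (simp add: f_def two_powr_def)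
    ultimately show ?thesis
      by (simp add: U.emeasure_eq_measure ennreal_power prod_ennreal)
  qed
  have "emeasure (Q V) (clique_event V V) =
      (\<integral>\<^sup>+y. emeasure (\<Pi>\<^sub>M v\<in>V. unif) {x \<in> space (\<Pi>\<^sub>M v\<in>V. unif).
        \<forall>(u, v)\<in>edges V. circle_dist (x u) (x v) \<le> radius (y u) (y v)} ^ d \<partial>(\<Pi>\<^sub>M v\<in>V. W))"
    unfolding clique_event_def pairwise_girg_adj_iff
    by (intro emeasure_vertex_product_eq V(1) prob_space_W sets_W) measurable
  also have "\<dots> \<le> (\<integral>\<^sup>+y. (\<Prod>v\<in>V. ennreal (f (c * y v))) \<partial>(\<Pi>\<^sub>M v\<in>V. W))"
  proof (rule nn_integral_mono_AE)
    have "AE y in (\<Pi>\<^sub>M v\<in>V. W). \<forall>v\<in>V. w0 \<le> y v"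
      using V(1) AE_W_ge prob_space_W
      by (intro AE_finite_allI AE_PiM_component) auto
    then show "AE y in (\<Pi>\<^sub>M v\<in>V. W). emeasure (\<Pi>\<^sub>M v\<in>V. unif) {x \<in> space (\<Pi>\<^sub>M v\<in>V. unif).
        \<forall>(u, v)\<in>edges V. circle_dist (x u) (x v) \<le> radius (y u) (y v)} ^ d
      \<le> (\<Prod>v\<in>V. ennreal (f (c * y v)))"
      by eventually_elim (intro pointwise, blast)
  qed
  also have "\<dots> = (\<Prod>v\<in>V. \<integral>\<^sup>+w. ennreal (f (c * w)) \<partial>W)"
    using V(1) by (intro PW.product_nn_integral_prod) (auto simp: f_def two_powr_def)
  also have "\<dots> \<le> ennreal (b ^ card V)"
  proof -
    have "(\<integral>\<^sup>+w. ennreal (f (c * w)) \<partial>W) \<le> ennreal b"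
      unfolding f_def c_def b_def C using nn_integral_W_two_powr_le[of "2 * s" "\<gamma> * (1 + s)"] s \<gamma>
      by simp
    moreover from this obtain r where "(\<integral>\<^sup>+w. ennreal (f (c * w)) \<partial>W) = ennreal r" "0 \<le> r"
      by (cases "\<integral>\<^sup>+w. ennreal (f (c * w)) \<partial>W") (auto simp: top_unique)
    ultimately show ?thesis
      using b0 by (simp add: ennreal_power power_mono)
  qed
  finally show ?thesis
    using b0 by (simp add: Q.emeasure_eq_measure b_def)
qed

lemma measure_clique_event_ge:
  assumes "finite S"
  shows "measure W {sqrt (real n / lam)<..} ^ card S \<le> measure (Q S) (clique_event S S)"
proof -
  interpret T: prob_space "torus_measure d" by (rule prob_space_torus_measure)
  interpret W: prob_space W by (rule prob_space_W)
  interpret Q: prob_space "Q S" by (rule prob_space_Q)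
  interpret product_prob_space "\<lambda>_::nat. W \<Otimes>\<^sub>M torus_measure d" S
    by (rule product_prob_space_WT)
  let ?H = "{sqrt (real n / lam)<..} \<times> space (torus_measure d)"
  have H: "?H \<in> sets (W \<Otimes>\<^sub>M torus_measure d)"
    by (intro pair_measureI) (auto simp: sets_W)
  have "emeasure (Q S) (Pi\<^sub>E S (\<lambda>_. ?H)) = (\<Prod>v\<in>S. emeasure (W \<Otimes>\<^sub>M torus_measure d) ?H)"
    using assms H by (intro emeasure_PiM)
  also have "emeasure (W \<Otimes>\<^sub>M torus_measure d) ?H = ennreal (measure W {sqrt (real n / lam)<..})"
    by (subst T.emeasure_pair_measure_Times) (auto simp: sets_W T.emeasure_space_1 W.emeasure_eq_measure)
  finally have "emeasure (Q S) (Pi\<^sub>E S (\<lambda>_. ?H)) = ennreal (measure W {sqrt (real n / lam)<..} ^ card S)"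
    by (simp add: ennreal_power)
  then have "measure W {sqrt (real n / lam)<..} ^ card S = measure (Q S) (Pi\<^sub>E S (\<lambda>_. ?H))"
    by (simp add: measure_def)
  also have "\<dots> \<le> measure (Q S) (clique_event S S)"
  proof (rule Q.finite_measure_mono)
    show "Pi\<^sub>E S (\<lambda>_. ?H) \<subseteq> clique_event S S"
    proof
      fix G assume G: "G \<in> Pi\<^sub>E S (\<lambda>_. ?H)"
      then have "G \<in> space (Q S)"
        by (auto simp: space_PiM space_pair_measure space_W PiE_def Pi_iff)
      moreover have "pairwise (girg_adj lam n d G) S"
        using G by (intro pairwise_girg_adj_heavy) (auto simp: PiE_def Pi_iff mem_Times_iff less_imp_le)
      ultimately show "G \<in> clique_event S S" by (simp add: clique_event_def)
    qed
  qed (use assms sets_clique_event in auto)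
  finally show ?thesis .
qed

section \<open>Clique counts and tail events of the clique number\<close>

lemma expectation_girg_num_cliques:
  "(\<integral>G. real (girg_num_cliques lam n d k G) \<partial>girg_measure n \<beta> w0 d) =
    (\<Sum>S | S \<subseteq> {..<n} \<and> card S = k. measure (Q S) (clique_event S S))"
proof -
  interpret Q: prob_space "Q {..<n}" by (rule prob_space_Q)
  let ?\<S> = "{S. S \<subseteq> {..<n} \<and> card S = k}"
  have fin: "finite ?\<S>" by (rule finite_subset[of _ "Pow {..<n}"]) auto
  have "(\<integral>G. real (girg_num_cliques lam n d k G) \<partial>Q {..<n}) =
      (\<integral>G. (\<Sum>S\<in>?\<S>. indicator (clique_event {..<n} S) G) \<partial>Q {..<n})"
  proof (rule Bochner_Integration.integral_cong[OF refl])
    fix G assume G: "G \<in> space (Q {..<n})"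
    have "{S \<in> cliques {..<n} (girg_adj lam n d G). card S = k} = {S \<in> ?\<S>. G \<in> clique_event {..<n} S}"
      using G by (auto simp: cliques_def clique_event_def)
    then show "real (girg_num_cliques lam n d k G) = (\<Sum>S\<in>?\<S>. indicator (clique_event {..<n} S) G)"
      using fin by (simp add: girg_num_cliques_def num_cliques_def indicator_def
          sum.If_cases Int_def conj_commute)
  qed
  also have "\<dots> = (\<Sum>S\<in>?\<S>. measure (Q {..<n}) (clique_event {..<n} S))"
    using sets_clique_event[of "{..<n}"]
    by (subst Bochner_Integration.integral_sum)
      (auto simp: integrable_indicator_iff Q.emeasure_eq_measure Int_absorb2 sets.sets_into_space
        intro!: sum.cong)
  also have "\<dots> = (\<Sum>S\<in>?\<S>. measure (Q S) (clique_event S S))"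
    by (intro sum.cong refl measure_clique_event_restrict) auto
  finally show ?thesis by (simp add: girg_measure_eq)
qed

text \<open>Subsets of cliques are cliques, so a clique of size at least \<open>k\<close> contains
  one of size exactly \<open>k\<close>. The empty clique makes the maximum well defined.\<close>

lemma girg_clique_number_ge_iff:
  assumes "G \<in> space (Q {..<n})"
  shows "k \<le> girg_clique_number lam n d G \<longleftrightarrow> (\<exists>S. S \<subseteq> {..<n} \<and> card S = k \<and> G \<in> clique_event {..<n} S)"
proof -
  let ?C = "cliques {..<n} (girg_adj lam n d G)"
  have fin: "finite ?C"
    by (rule finite_subset[of _ "Pow {..<n}"]) (auto simp: cliques_def)
  have ne: "{} \<in> ?C" by (simp add: cliques_def)
  have "k \<le> girg_clique_number lam n d G \<longleftrightarrow> (\<exists>S\<in>?C. k \<le> card S)"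
    unfolding girg_clique_number_def clique_number_def using fin ne by (subst Max_ge_iff) auto
  also have "\<dots> \<longleftrightarrow> (\<exists>S\<in>?C. card S = k)"
  proof
    assume "\<exists>S\<in>?C. k \<le> card S"
    then obtain S T where "S \<in> ?C" "T \<subseteq> S" "card T = k"
      by (meson obtain_subset_with_card_n)
    then show "\<exists>S\<in>?C. card S = k"
      by (intro bexI[of _ T]) (auto simp: cliques_def intro: pairwise_subset)
  qed auto
  finally show ?thesis
    using assms by (auto simp: cliques_def clique_event_def)
qed

lemma sets_girg_clique_number_ge:
  "{G \<in> space (Q {..<n}). k \<le> girg_clique_number lam n d G} \<in> sets (Q {..<n})"
proof -
  have "{G \<in> space (Q {..<n}). k \<le> girg_clique_number lam n d G} =
      (\<Union>S\<in>{S. S \<subseteq> {..<n} \<and> card S = k}. clique_event {..<n} S)"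
    using girg_clique_number_ge_iff by (auto simp: clique_event_def)
  moreover have "finite {S. S \<subseteq> {..<n} \<and> card S = k}"
    by (rule finite_subset[of _ "Pow {..<n}"]) auto
  ultimately show ?thesis
    using sets_clique_event by (auto intro!: sets.finite_UN)
qed

text \<open>Union bound over the vertex sets of size \<open>k\<close>; the resulting sum is the
  expected clique count.\<close>

lemma prob_girg_clique_number_ge_le:
  "measure (Q {..<n}) {G \<in> space (Q {..<n}). k \<le> girg_clique_number lam n d G} \<le>
    (\<integral>G. real (girg_num_cliques lam n d k G) \<partial>girg_measure n \<beta> w0 d)"
proof -
  interpret Q: prob_space "Q {..<n}" by (rule prob_space_Q)
  let ?\<S> = "{S. S \<subseteq> {..<n} \<and> card S = k}"
  have fin: "finite ?\<S>" by (rule finite_subset[of _ "Pow {..<n}"]) auto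
  have "{G \<in> space (Q {..<n}). k \<le> girg_clique_number lam n d G} = (\<Union>S\<in>?\<S>. clique_event {..<n} S)"
    using girg_clique_number_ge_iff by (auto simp: clique_event_def)
  also have "measure (Q {..<n}) \<dots> \<le> (\<Sum>S\<in>?\<S>. measure (Q {..<n}) (clique_event {..<n} S))"
    using fin sets_clique_event by (intro Q.finite_measure_subadditive_finite) auto
  also have "\<dots> = (\<Sum>S\<in>?\<S>. measure (Q S) (clique_event S S))"
    by (intro sum.cong refl measure_clique_event_restrict) auto
  finally show ?thesis by (simp add: expectation_girg_num_cliques)
qed

text \<open>Exponential Markov bound for the number of vertices of weight above \<open>sqrt (n / lam)\<close>.\<close>

lemma prob_girg_clique_number_less_le:
  "measure (Q {..<n}) {G \<in> space (Q {..<n}). girg_clique_number lam n d G < m} \<le>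
    2 ^ m * (1 - measure W {sqrt (real n / lam)<..} / 2) ^ n"
proof -
  define h where "h = sqrt (real n / lam)"
  define p where "p = measure W {h<..}"
  define a where "a = ennreal (1 / 2)"
  \<comment> \<open>\<open>g\<close> equals 1 / 2 on heavy vertices and 1 on light ones, so its
    product over all vertices is \<open>a ^ card H\<close> with \<open>H\<close> the heavy set.
    Since \<open>H\<close> is a clique, a clique number below \<open>m\<close> makes
    \<open>2 ^ m\<close> times this product at least 1.\<close>
  define g where "g z = a + a * indicator ({..h} \<times> space (torus_measure d)) z"
    for z :: "real \<times> (nat \<Rightarrow> real)"
  interpret W: prob_space W by (rule prob_space_W)
  interpret T: prob_space "torus_measure d" by (rule prob_space_torus_measure)
  interpret WT: prob_space "W \<Otimes>\<^sub>M torus_measure d" by (rule prob_space_WT)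
  interpret Q: prob_space "Q {..<n}" by (rule prob_space_Q)
  interpret product_prob_space "\<lambda>_::nat. W \<Otimes>\<^sub>M torus_measure d" "{..<n}"
    by (rule product_prob_space_WT)
  have a2: "a + a = 1"
    unfolding a_def by (subst ennreal_plus[symmetric]) auto
  have a_pow: "a ^ k = ennreal ((1 / 2) ^ k)" for k
    unfolding a_def by (rule ennreal_power) simp
  have p: "0 \<le> p" "p \<le> 1" by (simp_all add: p_def)
  have L [measurable]: "{..h} \<times> space (torus_measure d) \<in> sets (W \<Otimes>\<^sub>M torus_measure d)"
    by (intro pair_measureI) (auto simp: sets_W)
  have g [measurable]: "g \<in> borel_measurable (W \<Otimes>\<^sub>M torus_measure d)"
    unfolding g_def by measurable
  have "measure W {..h} = 1 - p"
    using W.prob_compl[of "{h<..}"] by (simp add: p_def space_W sets_W Compl_eq_Diff_UNIV[symmetric])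
  then have int_g: "(\<integral>\<^sup>+z. g z \<partial>(W \<Otimes>\<^sub>M torus_measure d)) = ennreal (1 - p / 2)"
  proof -
    assume *: "measure W {..h} = 1 - p"
    have "(\<integral>\<^sup>+z. g z \<partial>(W \<Otimes>\<^sub>M torus_measure d)) = a + a *
        emeasure (W \<Otimes>\<^sub>M torus_measure d) ({..h} \<times> space (torus_measure d))"
      unfolding g_def
      by (subst nn_integral_add) (auto simp: nn_integral_cmult_indicator WT.emeasure_space_1)
    also have "emeasure (W \<Otimes>\<^sub>M torus_measure d) ({..h} \<times> space (torus_measure d)) = ennreal (1 - p)"
      using * by (subst T.emeasure_pair_measure_Times)
        (auto simp: sets_W T.emeasure_space_1 W.emeasure_eq_measure)
    also have "a + a * ennreal (1 - p) = ennreal (1 / 2 + 1 / 2 * (1 - p))"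
      unfolding a_def using p by (subst ennreal_plus, simp, simp, subst ennreal_mult) auto
    finally show ?thesis by (simp add: field_simps)
  qed
  let ?E = "{G \<in> space (Q {..<n}). girg_clique_number lam n d G < m}"
  have E: "?E \<in> sets (Q {..<n})"
  proof -
    have "?E = space (Q {..<n}) - {G \<in> space (Q {..<n}). m \<le> girg_clique_number lam n d G}"
      by auto
    then show ?thesis using sets_girg_clique_number_ge by auto
  qed
  have "emeasure (Q {..<n}) ?E = (\<integral>\<^sup>+G. indicator ?E G \<partial>Q {..<n})"
    using E by simp
  also have "\<dots> \<le> (\<integral>\<^sup>+G. 2 ^ m * (\<Prod>v<n. g (G v)) \<partial>Q {..<n})"
  proof (rule nn_integral_mono)
    fix G assume G: "G \<in> space (Q {..<n})"
    show "indicator ?E G \<le> 2 ^ m * (\<Prod>v<n. g (G v))"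
    proof (cases "girg_clique_number lam n d G < m")
      case True
      define H where "H = {v \<in> {..<n}. h < fst (G v)}"
      have "pairwise (girg_adj lam n d G) H"
        by (intro pairwise_girg_adj_heavy) (auto simp: H_def h_def)
      then have "card H \<le> girg_clique_number lam n d G"
        using G by (subst girg_clique_number_ge_iff, simp, intro exI[of _ H])
          (auto simp: clique_event_def H_def)
      with True have card: "card H \<le> m" by simp
      have "(\<Prod>v<n. g (G v)) = (\<Prod>v<n. if v \<in> H then a else 1)"
      proof (intro prod.cong refl)
        fix v assume v: "v \<in> {..<n}"
        have "snd (G v) \<in> space (torus_measure d)"
          using G v by (auto simp: space_PiM PiE_def Pi_iff space_pair_measure mem_Times_iff)
        then show "g (G v) = (if v \<in> H then a else 1)"
          using v a2 by (auto simp: g_def H_def indicator_def mem_Times_iff)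
      qed
      also have "\<dots> = a ^ card H"
        by (simp add: prod.If_cases H_def Int_def)
      finally have prod_eq: "(\<Prod>v<n. g (G v)) = a ^ card H" .
      have "(1::ennreal) = ennreal (2 ^ card H * (1 / 2) ^ card H)"
        by (simp add: power_one_over)
      also have "\<dots> \<le> ennreal (2 ^ m * (1 / 2) ^ card H)"
        using card by (intro ennreal_leI mult_right_mono power_increasing) auto
      also have "\<dots> = 2 ^ m * a ^ card H"
        unfolding a_pow by (subst ennreal_mult) (auto simp flip: ennreal_power)
      finally show ?thesis
        using prod_eq by (simp add: indicator_def)
    qed simp
  qed
  also have "\<dots> = 2 ^ m * (\<Prod>v<n. \<integral>\<^sup>+z. g z \<partial>(W \<Otimes>\<^sub>M torus_measure d))"
  proof -
    have "(\<integral>\<^sup>+G. (\<Prod>v<n. g (G v)) \<partial>Q {..<n}) = (\<Prod>v<n. \<integral>\<^sup>+z. g z \<partial>(W \<Otimes>\<^sub>M torus_measure d))"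
      by (rule product_nn_integral_prod) auto
    then show ?thesis by (subst nn_integral_cmult) auto
  qed
  also have "\<dots> = ennreal (2 ^ m * (1 - p / 2) ^ n)"
  proof -
    have "(2::ennreal) ^ m = ennreal (2 ^ m)"
      by (simp flip: ennreal_power)
    then show ?thesis
      using p by (simp add: int_g ennreal_mult' ennreal_power)
  qed
  finally have "ennreal (measure (Q {..<n}) ?E) \<le> ennreal (2 ^ m * (1 - p / 2) ^ n)"
    by (simp add: Q.emeasure_eq_measure)
  moreover have "0 \<le> 2 ^ m * (1 - p / 2) ^ n"
    using p by simp
  ultimately show ?thesis
    unfolding p_def h_def by (simp only: ennreal_le_iff)
qed

end

section \<open>Asymptotics\<close>

text \<open>\<open>k ^ k / fact k\<close> is one term of the series of \<open>exp k\<close>, which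
  bounds \<open>fact k\<close> from below.\<close>

lemma binomial_le_exp_power:
  assumes "k > 0"
  shows "real (n choose k) \<le> (exp 1 * real n / real k) ^ k"
proof -
  have "real k ^ k /\<^sub>R fact k \<le> exp (real k)"
    using sum_le_suminf[OF summable_exp_generic[of "real k"], of "{k}"] by (simp add: exp_def)
  then have "real k ^ k / fact k \<le> exp (real k)"
    by (simp add: divide_inverse mult.commute)
  then have fact_ge: "real k ^ k \<le> exp (real k) * fact k"
    by (subst (asm) pos_divide_le_eq) simp_all
  have "real ((n choose k) * fact k) \<le> real (n ^ k)"
    by (subst of_nat_le_iff) (rule binomial_fact_pow)
  then have "real (n choose k) * fact k \<le> real n ^ k" by simp
  then have "real (n choose k) * real k ^ k \<le> exp (real k) * real n ^ k"
  proof -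
    have "real (n choose k) * real k ^ k \<le> real (n choose k) * (exp (real k) * fact k)"
      using fact_ge by (rule mult_left_mono) simp
    also have "\<dots> = exp (real k) * (real (n choose k) * fact k)"
      by (simp only: mult_ac)
    also have "\<dots> \<le> exp (real k) * real n ^ k"
      using \<open>real (n choose k) * fact k \<le> real n ^ k\<close> by (rule mult_left_mono) simp
    finally show ?thesis .
  qed
  then have "real (n choose k) \<le> exp (real k) * real n ^ k / real k ^ k"
    using assms by (subst pos_le_divide_eq) simp_all
  also have "exp (real k) = exp 1 ^ k"
    by (simp flip: exp_of_nat_mult)
  finally show ?thesis
    by (simp only: power_divide power_mult_distrib)
qed

lemma powr_scaled_eq_power:
  fixes c x :: real
  assumes "0 < c" "0 < k" "0 < x"
  shows "x powr (real k / 2 * (3 - \<beta>)) * (c * real k) powr (- real k)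
    = (x powr ((3 - \<beta>) / 2) / (c * real k)) ^ k"
proof -
  have "(x powr ((3 - \<beta>) / 2)) ^ k = (x powr ((3 - \<beta>) / 2)) powr real k"
    using assms by (intro powr_realpow[symmetric]) simp
  also have "\<dots> = x powr ((3 - \<beta>) / 2 * real k)"
    by (rule powr_powr)
  also have "(3 - \<beta>) / 2 * real k = real k / 2 * (3 - \<beta>)"
    by simp
  finally have "x powr (real k / 2 * (3 - \<beta>)) = (x powr ((3 - \<beta>) / 2)) ^ k" ..
  moreover have "(c * real k) powr (- real k) = inverse ((c * real k) ^ k)"
    using assms unfolding powr_minus by (subst powr_realpow) simp_all
  ultimately show ?thesis
    by (simp only: power_divide divide_inverse[of "_ ^ k"])
qed

text \<open>This is where the growth of \<open>d\<close> enters. The edge probability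
  \<open>p\<close> is at least of order 1 / n, so \<open>- ln p\<close> is at most
  \<open>2 * ln n\<close> eventually and hence at most \<open>\<epsilon>0 * d\<close>. The factor 2
  absorbs the constant \<open>ln a\<close>, which is why the little-o bound is taken with
  \<open>\<epsilon>0 / 2\<close>.\<close>

lemma eventually_light_edge_prob:
  fixes a \<epsilon>0 :: real and d :: "nat \<Rightarrow> nat"
  assumes "a > 0" "\<epsilon>0 > 0" and d: "(\<lambda>n. real (d n)) \<in> \<omega>(\<lambda>n. ln (real n))"
  shows "\<forall>\<^sub>F n in sequentially. d n > 0 \<and> 1 - \<epsilon>0 \<le> min 1 (a / real n) powr (1 / real (d n))"
proof -
  have "(\<lambda>n. ln (real n)) \<in> o(\<lambda>n. real (d n))"
    using d by (simp add: smallomega_iff_smallo)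
  then have 1: "\<forall>\<^sub>F n in sequentially. norm (ln (real n)) \<le> \<epsilon>0 / 2 * norm (real (d n))"
    by (rule landau_o.smallD) (use assms in auto)
  have lim: "filterlim (\<lambda>n. ln (real n)) at_top sequentially"
    by (rule filterlim_compose[OF ln_at_top filterlim_real_sequentially])
  then have 2: "\<forall>\<^sub>F n in sequentially. max 1 \<bar>ln a\<bar> \<le> ln (real n)"
    by (simp only: filterlim_at_top)
  show ?thesis
    using 1 2 eventually_gt_at_top[of 0]
  proof eventually_elim
    case (elim n)
    have ln: "1 \<le> ln (real n)" "\<bar>ln a\<bar> \<le> ln (real n)" using elim by auto
    have dn: "ln (real n) \<le> \<epsilon>0 / 2 * real (d n)" using elim ln by simp
    then have d0: "d n > 0"
      using ln by (cases "d n = 0") auto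
    define p where "p = min 1 (a / real n)"
    have p0: "p > 0" using assms elim by (simp add: p_def)
    have "ln p \<ge> - 2 * ln (real n)"
    proof (cases "a / real n \<le> 1")
      case True
      then have "ln p = ln a - ln (real n)"
        using assms elim by (simp add: p_def ln_div)
      then show ?thesis using ln by linarith
    next
      case False
      then show ?thesis using ln by (simp add: p_def)
    qed
    then have "- ln p \<le> \<epsilon>0 * real (d n)"
      using dn by linarith
    then have "- ln p / real (d n) \<le> \<epsilon>0"
      using d0 by (subst pos_divide_le_eq) simp_all
    then have "1 - \<epsilon>0 \<le> 1 + ln p / real (d n)" by simp
    also have "\<dots> \<le> exp (ln p / real (d n))" by (rule exp_ge_add_one_self)
    also have "\<dots> = p powr (1 / real (d n))"
      using p0 by (simp add: powr_def)
    finally show ?case using d0 by (simp add: p_def)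
  qed
qed

context girg
begin

section \<open>Bounds on clique counts and clique number for a fixed number of vertices\<close>

lemma real_n_times_powr:
  "real n * real n powr (- (\<beta> - 1) / 2) = real n powr ((3 - \<beta>) / 2)"
proof -
  have "real n * real n powr (- (\<beta> - 1) / 2) = real n powr (1 + - (\<beta> - 1) / 2)"
    using n_pos by (simp only: powr_add) simp
  also have "1 + - (\<beta> - 1) / 2 = (3 - \<beta>) / 2" by (simp add: field_simps)
  finally show ?thesis .
qed

lemma measure_W_heavy:
  assumes "w0 \<le> sqrt (real n / lam)"
  shows "measure W {sqrt (real n / lam)<..} = (w0 * sqrt lam) powr (\<beta> - 1) * real n powr (- (\<beta> - 1) / 2)"
proof -
  have "sqrt (real n / lam) / w0 = real n powr (1 / 2) / (w0 * sqrt lam)"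
    using lam_pos by (simp add: real_sqrt_divide powr_half_sqrt)
  then have "measure W {sqrt (real n / lam)<..} = (real n powr (1 / 2) / (w0 * sqrt lam)) powr (1 - \<beta>)"
    using measure_W_greaterThan[OF assms] by simp
  also have "\<dots> = (real n powr (1 / 2)) powr (1 - \<beta>) / (w0 * sqrt lam) powr (1 - \<beta>)"
    by (rule powr_divide)
  also have "\<dots> = (w0 * sqrt lam) powr (- (1 - \<beta>)) * (real n powr (1 / 2)) powr (1 - \<beta>)"
    by (simp only: powr_minus divide_inverse mult.commute)
  also have "(real n powr (1 / 2)) powr (1 - \<beta>) = real n powr (- (\<beta> - 1) / 2)"
    unfolding powr_powr by (rule arg_cong2[where f = "(powr)"]) (simp_all add: field_simps)
  finally show ?thesis by simp
qed

lemma card_subsets_of_size: "card {S. S \<subseteq> {..<n} \<and> card S = k} = n choose k"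
  using n_subsets[of "{..<n}" k] by simp

text \<open>Counts only the sets of heavy vertices. The binomial bound \<open>(n / k) ^ k\<close> is
  what brings in the restriction to \<open>k\<close> at most \<open>n\<close>.\<close>

lemma expectation_girg_num_cliques_ge:
  assumes "w0 \<le> sqrt (real n / lam)" "0 < k" "k \<le> n"
  shows "(real n powr ((3 - \<beta>) / 2) / (1 / (w0 * sqrt lam) powr (\<beta> - 1) * real k)) ^ k \<le>
    (\<integral>G. real (girg_num_cliques lam n d k G) \<partial>girg_measure n \<beta> w0 d)"
proof -
  define p where "p = measure W {sqrt (real n / lam)<..}"
  have p: "p = (w0 * sqrt lam) powr (\<beta> - 1) * real n powr (- (\<beta> - 1) / 2)"
    unfolding p_def by (rule measure_W_heavy[OF assms(1)])
  have "real n powr ((3 - \<beta>) / 2) / (1 / (w0 * sqrt lam) powr (\<beta> - 1) * real k) = real n / real k * p"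
    unfolding p using real_n_times_powr by simp
  then have "(real n powr ((3 - \<beta>) / 2) / (1 / (w0 * sqrt lam) powr (\<beta> - 1) * real k)) ^ k =
      (real n / real k) ^ k * p ^ k"
    by (simp only: power_mult_distrib)
  also have "\<dots> \<le> real (n choose k) * p ^ k"
    using binomial_ge_n_over_k_pow_k[OF assms(3), where 'a = real]
    by (intro mult_right_mono) (auto simp: p_def)
  also have "\<dots> = (\<Sum>S | S \<subseteq> {..<n} \<and> card S = k. p ^ k)"
    by (simp add: card_subsets_of_size)
  also have "\<dots> \<le> (\<Sum>S | S \<subseteq> {..<n} \<and> card S = k. measure (Q S) (clique_event S S))"
    using measure_clique_event_ge finite_subset[of _ "{..<n}"] by (intro sum_mono) (auto simp: p_def)
  finally show ?thesis by (simp add: expectation_girg_num_cliques)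
qed

lemma expectation_girg_num_cliques_le:
  assumes "0 < K" "3 \<le> k"
    and small: "\<And>V. finite V \<Longrightarrow> 3 \<le> card V \<Longrightarrow> card V \<le> 5 \<Longrightarrow>
      measure (Q V) (clique_event V V) \<le> (K * real n powr (- (\<beta> - 1) / 2)) ^ card V"
  shows "(\<integral>G. real (girg_num_cliques lam n d k G) \<partial>girg_measure n \<beta> w0 d) \<le>
    (real n powr ((3 - \<beta>) / 2) / (1 / (exp 1 * K) * real k)) ^ k"
proof -
  define b where "b = K * real n powr (- (\<beta> - 1) / 2)"
  have b0: "0 \<le> b" using assms by (simp add: b_def)
  have "(\<Sum>S | S \<subseteq> {..<n} \<and> card S = k. measure (Q S) (clique_event S S)) \<le>
      (\<Sum>S | S \<subseteq> {..<n} \<and> card S = k. b ^ k)"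
  proof (rule sum_mono)
    fix S assume "S \<in> {S. S \<subseteq> {..<n} \<and> card S = k}"
    then have S: "finite S" "card S = k" using finite_subset by auto
    have "measure (Q S) (clique_event S S) \<le> b ^ card S"
      by (rule measure_clique_event_le_power[OF small[folded b_def] b0]) (use S assms(2) in auto)
    then show "measure (Q S) (clique_event S S) \<le> b ^ k" using S by simp
  qed
  also have "\<dots> = real (n choose k) * b ^ k"
    by (simp add: card_subsets_of_size)
  also have "\<dots> \<le> (exp 1 * real n / real k) ^ k * b ^ k"
    using binomial_le_exp_power[of k n] assms b0 by (intro mult_right_mono) auto
  also have "\<dots> = (exp 1 * real n / real k * b) ^ k"
    by (simp only: power_mult_distrib)
  also have "exp 1 * real n / real k * b = real n powr ((3 - \<beta>) / 2) / (1 / (exp 1 * K) * real k)"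
  proof -
    have "exp 1 * real n / real k * (K * y) = real n * y / (1 / (exp 1 * K) * real k)" for y
      by simp
    then show ?thesis
      unfolding b_def by (simp only: real_n_times_powr)
  qed
  finally show ?thesis by (simp add: expectation_girg_num_cliques)
qed

text \<open>The first moment bounds the clique number from above; the exponential Markov bound for
  the heavy vertices, whose expected number is \<open>K' * N\<close>, bounds it from below.\<close>

lemma prob_girg_clique_number_between_ge:
  fixes K :: real
  defines "N \<equiv> real n powr ((3 - \<beta>) / 2)" and "K' \<equiv> (w0 * sqrt lam) powr (\<beta> - 1)"
  assumes "0 < K" "w0 \<le> sqrt (real n / lam)" "3 \<le> 2 * (exp 1 * K) * N"
    and small: "\<And>V. finite V \<Longrightarrow> 3 \<le> card V \<Longrightarrow> card V \<le> 5 \<Longrightarrow>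
      measure (Q V) (clique_event V V) \<le> (K * real n powr (- (\<beta> - 1) / 2)) ^ card V"
  shows "1 - 2 * exp (- (K' / 4) * N) - (1 / 2) powr (2 * (exp 1 * K) * N) \<le>
    measure (girg_measure n \<beta> w0 d) {G \<in> space (girg_measure n \<beta> w0 d).
      K' / 4 * N \<le> real (girg_clique_number lam n d G) \<and>
      real (girg_clique_number lam n d G) \<le> 2 * (exp 1 * K) * N}"
proof -
  interpret Q: prob_space "Q {..<n}" by (rule prob_space_Q)
  \<comment> \<open>For \<open>k\<close> above \<open>c * N\<close> the base
    \<open>exp 1 * K * N / k\<close> is at most 1 / 2, so the expected number of cliques of size
    \<open>k\<close> is at most \<open>(1 / 2) ^ k\<close>.\<close>
  define c where "c = 2 * (exp 1 * K)"
  define m where "m = nat \<lceil>K' / 4 * N\<rceil>"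
  define k where "k = nat \<lfloor>c * N\<rfloor> + 1"
  let ?cn = "girg_clique_number lam n d"
  let ?sp = "space (Q {..<n})"
  define p where "p = measure W {sqrt (real n / lam)<..}"
  have N0: "0 < N" using n_pos by (simp add: N_def)
  have K'0: "0 < K'" using w0_pos lam_pos by (simp add: K'_def)
  have c0: "0 < c" using assms by (simp add: c_def)
  have p: "0 \<le> p" "p \<le> 1" "real n * p = K' * N"
  proof -
    interpret W: prob_space W by (rule prob_space_W)
    show "0 \<le> p" "p \<le> 1" by (simp_all add: p_def)
    have "p = K' * real n powr (- (\<beta> - 1) / 2)"
      unfolding p_def K'_def by (rule measure_W_heavy) fact
    then have "real n * p = K' * (real n * real n powr (- (\<beta> - 1) / 2))"
      by simp
    then show "real n * p = K' * N"
      by (simp only: real_n_times_powr N_def)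
  qed
  have k_real: "real k > c * N" "real k \<ge> 3"
  proof -
    have "real k = of_int \<lfloor>c * N\<rfloor> + 1"
      using c0 N0 by (simp add: k_def)
    then show "real k > c * N" by linarith
    then show "real k \<ge> 3" using assms by (simp add: c_def)
  qed
  have upper: "measure (Q {..<n}) {G \<in> ?sp. k \<le> ?cn G} \<le> (1 / 2) powr (c * N)"
  proof -
    have "measure (Q {..<n}) {G \<in> ?sp. k \<le> ?cn G} \<le>
        (N / (1 / (exp 1 * K) * real k)) ^ k"
      using prob_girg_clique_number_ge_le[of k] expectation_girg_num_cliques_le[OF assms(3) _ small, of k]
        k_real by (simp add: N_def)
    also have "\<dots> \<le> (1 / 2) ^ k"
    proof (rule power_mono)
      have "N * (2 * (exp 1 * K)) \<le> real k"
        using k_real by (simp add: c_def mult_ac)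
      then have "N * (exp 1 * K) / real k \<le> 1 / 2"
        by (subst pos_divide_le_eq) (use k_real in linarith)+
      then show "N / (1 / (exp 1 * K) * real k) \<le> 1 / 2"
        by simp
    qed (use N0 assms(3) in auto)
    also have "\<dots> = (1 / 2) powr real k"
      by (rule powr_realpow[symmetric]) simp
    also have "\<dots> \<le> (1 / 2) powr (c * N)"
      using k_real by (intro powr_mono') auto
    finally show ?thesis .
  qed
  have lower: "measure (Q {..<n}) {G \<in> ?sp. ?cn G < m} \<le> 2 * exp (- (K' / 4) * N)"
  proof -
    have "measure (Q {..<n}) {G \<in> ?sp. ?cn G < m} \<le> 2 ^ m * (1 - p / 2) ^ n"
      unfolding p_def by (rule prob_girg_clique_number_less_le)
    \<comment> \<open>The quarter in \<open>m\<close> is chosen so that \<open>2 ^ m\<close> is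
      outweighed by the decay \<open>exp (- (K' / 2) * N)\<close>. The leading 2 pays for rounding
      \<open>m\<close> up.\<close>
    also have "\<dots> \<le> (2 * exp (K' / 4 * N)) * exp (- (K' / 2) * N)"
    proof (rule mult_mono)
      have "real m = of_int \<lceil>K' / 4 * N\<rceil>"
        using K'0 N0 by (simp add: m_def)
      then have m: "real m \<le> K' / 4 * N + 1" by linarith
      have "(2::real) ^ m = 2 powr real m"
        by (rule powr_realpow[symmetric]) simp
      also have "\<dots> = exp (ln 2 * real m)"
        by (simp add: powr_def)
      also have "\<dots> \<le> exp (ln 2 * (K' / 4 * N + 1))"
        using m by simp
      also have "\<dots> = 2 * exp (ln 2 * (K' / 4 * N))"
        by (simp add: distrib_left exp_add)
      also have "\<dots> \<le> 2 * exp (1 * (K' / 4 * N))"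
        using K'0 N0 ln_2_less_1 by (intro mult_left_mono iffD2[OF exp_le_cancel_iff] mult_right_mono) auto
      finally show "(2::real) ^ m \<le> 2 * exp (K' / 4 * N)" by simp
      have "(1 - p / 2) ^ n \<le> exp (- (p / 2)) ^ n"
        using p exp_ge_add_one_self[of "- (p / 2)"] by (intro power_mono) auto
      also have "\<dots> = exp (- (real n * p / 2))"
        by (simp flip: exp_of_nat_mult)
      finally show "(1 - p / 2) ^ n \<le> exp (- (K' / 2) * N)"
        using p by simp
    qed (use p in auto)
    also have "\<dots> = 2 * (exp (K' / 4 * N) * exp (- (K' / 2) * N))" by simp
    also have "exp (K' / 4 * N) * exp (- (K' / 2) * N) = exp (- (K' / 4) * N)"
      unfolding exp_add[symmetric] by (rule arg_cong[where f = exp]) (simp add: field_simps)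
    finally show ?thesis .
  qed
  have m_iff: "K' / 4 * N \<le> real j \<longleftrightarrow> m \<le> j" for j
    unfolding m_def by linarith
  have k_iff: "real j \<le> c * N \<longleftrightarrow> \<not> k \<le> j" for j
  proof -
    have "0 \<le> c * N" using c0 N0 by simp
    then show ?thesis unfolding k_def by linarith
  qed
  let ?good = "{G \<in> ?sp. K' / 4 * N \<le> real (?cn G) \<and> real (?cn G) \<le> c * N}"
  have good: "?good = {G \<in> ?sp. m \<le> ?cn G} - {G \<in> ?sp. k \<le> ?cn G}"
    unfolding m_iff k_iff by auto
  have "{G \<in> ?sp. ?cn G < m} = ?sp - {G \<in> ?sp. m \<le> ?cn G}" by auto
  then have "measure (Q {..<n}) {G \<in> ?sp. m \<le> ?cn G} = 1 - measure (Q {..<n}) {G \<in> ?sp. ?cn G < m}"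
    using Q.prob_compl[OF sets_girg_clique_number_ge[of m]] by simp
  moreover have "measure (Q {..<n}) {G \<in> ?sp. m \<le> ?cn G} \<le>
      measure (Q {..<n}) (?good \<union> {G \<in> ?sp. k \<le> ?cn G})"
    unfolding good using sets_girg_clique_number_ge by (intro Q.finite_measure_mono) auto
  moreover have "measure (Q {..<n}) (?good \<union> {G \<in> ?sp. k \<le> ?cn G}) \<le>
      measure (Q {..<n}) ?good + measure (Q {..<n}) {G \<in> ?sp. k \<le> ?cn G}"
    unfolding good using sets_girg_clique_number_ge by (intro measure_Un_le) auto
  ultimately show ?thesis
    unfolding girg_measure_eq c_def[symmetric] using upper lower by linarith
qed

end

text \<open>Fixes \<open>s\<close>, \<open>\<gamma>\<close> and \<open>\<epsilon>0\<close> from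
  \<beta> alone, so that \<open>K\<close> does not depend on \<open>n\<close> or \<open>d\<close>;
  only the threshold for \<open>n\<close> depends on how fast \<open>d\<close> grows.\<close>

lemma eventually_girg_small_clique_bound:
  fixes lam w0 \<beta> :: real and d :: "nat \<Rightarrow> nat"
  assumes "lam > 0" "w0 > 0" "\<beta> > 2" "\<beta> < 3" "(\<lambda>n. real (d n)) \<in> \<omega>(\<lambda>n. ln (real n))"
  obtains K where "K > 0" "\<forall>\<^sub>F n in sequentially. girg lam w0 \<beta> n (d n) \<and> w0 \<le> sqrt (real n / lam) \<and>
    (\<forall>V. finite V \<longrightarrow> 3 \<le> card V \<longrightarrow> card V \<le> 5 \<longrightarrow>
      measure (\<Pi>\<^sub>M v\<in>V. weight_measure \<beta> w0 \<Otimes>\<^sub>M torus_measure (d n))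
        (girg.clique_event lam w0 \<beta> n (d n) V V) \<le> (K * real n powr (- (\<beta> - 1) / 2)) ^ card V)"
proof -
  \<comment> \<open>\<open>(3 * \<beta> - 5) / 4\<close> is the midpoint of \<beta> - 2 and (\<beta>
    - 1) / 2, whose order uses \<beta> < 3. Raising it to 1 / 2 is compatible with
    \<open>2 * s < \<beta> - 1\<close> because \<beta> > 2.\<close>
  define s where "s = max (1 / 2) ((3 * \<beta> - 5) / 4)"
  have s: "1 / 2 \<le> s" "s \<le> 1" "2 * s < \<beta> - 1" "\<beta> - 1 < 1 + s"
    unfolding s_def using assms(3,4) by (auto simp: max_def field_simps)
  \<comment> \<open>\<open>r\<close> is the value that \<gamma> must exceed; \<gamma> is taken
    halfway between \<open>r\<close> and 1.\<close>
  define r where "r = (\<beta> - 1) / (1 + s)"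
  define \<gamma> where "\<gamma> = (1 + r) / 2"
  have r: "0 < r" "r < 1"
    using s assms by (auto simp: r_def)
  have "r * (1 + s) = \<beta> - 1"
    using s by (simp add: r_def)
  moreover have "r * (1 + s) < \<gamma> * (1 + s)"
    using r s by (intro mult_strict_right_mono) (auto simp: \<gamma>_def)
  ultimately have \<gamma>: "0 < \<gamma>" "\<gamma> \<le> 1" "\<gamma> < 1" "\<beta> - 1 < \<gamma> * (1 + s)"
    using r by (simp_all add: \<gamma>_def)
  \<comment> \<open>26 = 25 + 1: expanding \<open>(1 - 25 * \<epsilon>0) * (1 - \<epsilon>0)\<close>
    gives at least \<open>1 - 26 * \<epsilon>0\<close>, which is \<gamma>.\<close>
  define \<epsilon>0 where "\<epsilon>0 = (1 - \<gamma>) / 26"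
  have \<epsilon>0: "0 < \<epsilon>0" "\<epsilon>0 < 1" "\<gamma> \<le> (1 - 25 * \<epsilon>0) * (1 - \<epsilon>0)"
  proof -
    show e: "0 < \<epsilon>0" "\<epsilon>0 < 1" using \<gamma> by (auto simp: \<epsilon>0_def)
    have "\<gamma> = 1 - 26 * \<epsilon>0" by (simp add: \<epsilon>0_def field_simps)
    then show "\<gamma> \<le> (1 - 25 * \<epsilon>0) * (1 - \<epsilon>0)"
      by (simp add: algebra_simps)
  qed
  define C where "C = 2 powr (\<beta> - 1) / (1 - 2 powr (\<beta> - 1 - \<gamma> * (1 + s))) +
       2 powr (2 * s) / (1 - 2 powr (2 * s - (\<beta> - 1)))"
  have "2 powr (\<beta> - 1 - \<gamma> * (1 + s)) < 1" "2 powr (2 * s - (\<beta> - 1)) < 1"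
    using s \<gamma> powr_less_mono[of "\<beta> - 1 - \<gamma> * (1 + s)" 0 2] powr_less_mono[of "2 * s - (\<beta> - 1)" 0 2]
    by simp_all
  then have "C > 0"
    unfolding C_def by (intro add_pos_pos divide_pos_pos) auto
  define K where "K = C * (w0 * sqrt lam) powr (\<beta> - 1)"
  have K: "K > 0" using \<open>C > 0\<close> assms by (simp add: K_def)
  have "lam * w0\<^sup>2 > 0" using assms by simp
  from eventually_light_edge_prob[OF this \<epsilon>0(1) assms(5)]
  have 1: "\<forall>\<^sub>F n in sequentially. d n > 0 \<and>
    1 - \<epsilon>0 \<le> min 1 (lam * w0\<^sup>2 / real n) powr (1 / real (d n))" .
  have 2: "\<forall>\<^sub>F n in sequentially. lam * w0\<^sup>2 \<le> real n"
    using filterlim_real_sequentially by (simp add: filterlim_at_top)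
  show thesis
  proof (rule that[OF K])
    show "\<forall>\<^sub>F n in sequentially. girg lam w0 \<beta> n (d n) \<and> w0 \<le> sqrt (real n / lam) \<and>
    (\<forall>V. finite V \<longrightarrow> 3 \<le> card V \<longrightarrow> card V \<le> 5 \<longrightarrow>
      measure (\<Pi>\<^sub>M v\<in>V. weight_measure \<beta> w0 \<Otimes>\<^sub>M torus_measure (d n))
        (girg.clique_event lam w0 \<beta> n (d n) V V) \<le> (K * real n powr (- (\<beta> - 1) / 2)) ^ card V)"
      using 1 2 eventually_gt_at_top[of 0]
    proof eventually_elim
      case (elim n)
      interpret girg lam w0 \<beta> n "d n"
        using assms elim by unfold_locales auto
      have "w0\<^sup>2 \<le> real n / lam"
        using elim assms by (simp add: field_simps)
      then have "w0 \<le> sqrt (real n / lam)"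
        by (rule real_le_rsqrt)
      moreover have "measure (Q V) (clique_event V V) \<le> (K * real n powr (- (\<beta> - 1) / 2)) ^ card V"
        if "finite V" "3 \<le> card V" "card V \<le> 5" for V
        unfolding K_def using elim
        by (intro measure_clique_event_small_le[OF that s(1-3) \<gamma>(1,2,4) \<epsilon>0(3) _ \<epsilon>0(2) _ C_def])
          (use \<epsilon>0 in auto)
      ultimately show ?case
        using girg_axioms by blast
    qed
  qed
qed

text \<open>The threshold for \<open>n\<close> precedes \<open>k\<close>, so the estimates are
  uniform in the clique size. The lower bound is stated for \<open>k \<le> n\<close>, since larger
  cliques do not exist while the bound is positive.\<close>

theorem theorem30:
  fixes lam w0 \<beta> :: real and d :: "nat \<Rightarrow> nat"
  assumes "lam > 0" and "w0 > 0" and "\<beta> > 2" and "\<beta> < 3"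
    and "(\<lambda>n. real (d n)) \<in> \<omega>(\<lambda>n. ln (real n))"
  shows
    "(\<exists>c1>0. \<exists>c2>0. \<forall>\<^sub>F n in sequentially. \<forall>k\<ge>3.
        (k \<le> n \<longrightarrow>
          real n powr (real k / 2 * (3 - \<beta>)) * (c1 * real k) powr (- real k)
            \<le> (\<integral>G. real (girg_num_cliques lam n (d n) k G) \<partial>girg_measure n \<beta> w0 (d n))) \<and>
        (\<integral>G. real (girg_num_cliques lam n (d n) k G) \<partial>girg_measure n \<beta> w0 (d n))
          \<le> real n powr (real k / 2 * (3 - \<beta>)) * (c2 * real k) powr (- real k)) \<and>
     (\<exists>c1>0. \<exists>c2>0.
        (\<lambda>n. measure (girg_measure n \<beta> w0 (d n))
               {G \<in> space (girg_measure n \<beta> w0 (d n)).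
                  c1 * real n powr ((3 - \<beta>) / 2) \<le> real (girg_clique_number lam n (d n) G) \<and>
                  real (girg_clique_number lam n (d n) G) \<le> c2 * real n powr ((3 - \<beta>) / 2)})
          \<longlonglongrightarrow> 1)"
proof -
  obtain K where K: "K > 0"
    and ev: "\<forall>\<^sub>F n in sequentially. girg lam w0 \<beta> n (d n) \<and> w0 \<le> sqrt (real n / lam) \<and>
    (\<forall>V. finite V \<longrightarrow> 3 \<le> card V \<longrightarrow> card V \<le> 5 \<longrightarrow>
      measure (\<Pi>\<^sub>M v\<in>V. weight_measure \<beta> w0 \<Otimes>\<^sub>M torus_measure (d n))
        (girg.clique_event lam w0 \<beta> n (d n) V V) \<le> (K * real n powr (- (\<beta> - 1) / 2)) ^ card V)"
    by (rule eventually_girg_small_clique_bound[OF assms]) (rule that)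
  define K' where "K' = (w0 * sqrt lam) powr (\<beta> - 1)"
  have K': "K' > 0" using assms by (simp add: K'_def)
  define N where "N n = real n powr ((3 - \<beta>) / 2)" for n
  \<comment> \<open>Here \<beta> < 3 makes the typical clique number diverge, so both error terms of
    the concentration bound vanish.\<close>
  have N: "filterlim N at_top sequentially"
  proof -
    have "filterlim (\<lambda>n. (3 - \<beta>) / 2 * ln (real n)) at_top sequentially"
      using assms(4) filterlim_compose[OF ln_at_top filterlim_real_sequentially]
      by (intro filterlim_tendsto_pos_mult_at_top[OF tendsto_const]) auto
    then have "filterlim (\<lambda>n. exp ((3 - \<beta>) / 2 * ln (real n))) at_top sequentially"
      by (rule filterlim_compose[OF exp_at_top])
    moreover have "\<forall>\<^sub>F n in sequentially. exp ((3 - \<beta>) / 2 * ln (real n)) = N n"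
      using eventually_gt_at_top[of 0] by eventually_elim (simp add: N_def powr_def)
    ultimately show ?thesis
      using filterlim_cong[OF refl refl] by fast
  qed
  have num: "\<forall>\<^sub>F n in sequentially. \<forall>k\<ge>3.
      (k \<le> n \<longrightarrow>
        real n powr (real k / 2 * (3 - \<beta>)) * (1 / K' * real k) powr (- real k)
          \<le> (\<integral>G. real (girg_num_cliques lam n (d n) k G) \<partial>girg_measure n \<beta> w0 (d n))) \<and>
      (\<integral>G. real (girg_num_cliques lam n (d n) k G) \<partial>girg_measure n \<beta> w0 (d n))
        \<le> real n powr (real k / 2 * (3 - \<beta>)) * (1 / (exp 1 * K) * real k) powr (- real k)"
    using ev
  proof eventually_elim
    case (elim n)
    then interpret girg lam w0 \<beta> n "d n" by blast
    show ?case
    proof (intro allI impI conjI)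
      fix k :: nat assume k: "3 \<le> k" "k \<le> n"
      have "real n powr (real k / 2 * (3 - \<beta>)) * (1 / K' * real k) powr (- real k) =
          (real n powr ((3 - \<beta>) / 2) / (1 / K' * real k)) ^ k"
        using K' n_pos k by (intro powr_scaled_eq_power) auto
      also have "\<dots> \<le> (\<integral>G. real (girg_num_cliques lam n (d n) k G) \<partial>girg_measure n \<beta> w0 (d n))"
        unfolding K'_def using elim k by (intro expectation_girg_num_cliques_ge) auto
      finally show "real n powr (real k / 2 * (3 - \<beta>)) * (1 / K' * real k) powr (- real k) \<le>
          (\<integral>G. real (girg_num_cliques lam n (d n) k G) \<partial>girg_measure n \<beta> w0 (d n))" .
    next
      fix k :: nat assume k: "3 \<le> k"
      have "(\<integral>G. real (girg_num_cliques lam n (d n) k G) \<partial>girg_measure n \<beta> w0 (d n)) \<le>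
          (real n powr ((3 - \<beta>) / 2) / (1 / (exp 1 * K) * real k)) ^ k"
        using elim K k by (intro expectation_girg_num_cliques_le) auto
      also have "\<dots> = real n powr (real k / 2 * (3 - \<beta>)) * (1 / (exp 1 * K) * real k) powr (- real k)"
        using K n_pos k by (intro powr_scaled_eq_power[symmetric]) auto
      finally show "(\<integral>G. real (girg_num_cliques lam n (d n) k G) \<partial>girg_measure n \<beta> w0 (d n)) \<le>
          real n powr (real k / 2 * (3 - \<beta>)) * (1 / (exp 1 * K) * real k) powr (- real k)" .
    qed
  qed
  have number: "(\<lambda>n. measure (girg_measure n \<beta> w0 (d n))
               {G \<in> space (girg_measure n \<beta> w0 (d n)).
                  K' / 4 * N n \<le> real (girg_clique_number lam n (d n) G) \<and>
                  real (girg_clique_number lam n (d n) G) \<le> 2 * (exp 1 * K) * N n})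
          \<longlonglongrightarrow> 1" (is "?P \<longlonglongrightarrow> 1")
  proof (rule tendsto_sandwich)
    have big: "\<forall>\<^sub>F n in sequentially. 3 / (2 * (exp 1 * K)) \<le> N n"
      using N by (simp only: filterlim_at_top)
    show "\<forall>\<^sub>F n in sequentially.
        1 - 2 * exp (- (K' / 4) * N n) - (1 / 2) powr (2 * (exp 1 * K) * N n) \<le> ?P n"
      using ev big
    proof eventually_elim
      case (elim n)
      then interpret girg lam w0 \<beta> n "d n" by blast
      have "3 \<le> 2 * (exp 1 * K) * N n"
        using elim K by (simp add: field_simps)
      then show ?case
        unfolding N_def K'_def using elim K by (intro prob_girg_clique_number_between_ge) auto
    qed
    show "\<forall>\<^sub>F n in sequentially. ?P n \<le> 1"
      using prob_space.prob_le_1[OF prob_space_girg_measure] assms by simp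
    have "((\<lambda>x. 1 - 2 * exp (- (K' / 4) * x) - (1 / 2) powr (2 * (exp 1 * K) * x)) \<longlongrightarrow> 1) at_top"
    proof -
      have lim: "filterlim (\<lambda>x. - c * x) at_bot at_top" if "c > 0" for c :: real
        using that by (intro filterlim_tendsto_neg_mult_at_bot[OF tendsto_const] filterlim_ident) auto
      have exp0: "((\<lambda>x. exp (- c * x)) \<longlongrightarrow> 0) at_top" if "c > 0" for c :: real
        using filterlim_compose[OF exp_at_bot lim[OF that]] .
      have half: "(1 / 2) powr (2 * (exp 1 * K) * x) = exp (- (2 * (exp 1 * K) * ln 2) * x)" for x :: real
        by (simp add: powr_def ln_div)
      have "K' / 4 > 0" "2 * (exp 1 * K) * ln 2 > 0"
        using K K' by simp_all
      then have "((\<lambda>x. 1 - 2 * exp (- (K' / 4) * x) - (1 / 2) powr (2 * (exp 1 * K) * x))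
          \<longlongrightarrow> 1 - 2 * 0 - 0) at_top"
        unfolding half by (intro tendsto_diff tendsto_mult tendsto_const exp0)
      then show ?thesis by simp
    qed
    from filterlim_compose[OF this N]
    show "(\<lambda>n. 1 - 2 * exp (- (K' / 4) * N n) - (1 / 2) powr (2 * (exp 1 * K) * N n)) \<longlonglongrightarrow> 1" .
  qed simp
  have pos: "1 / K' > 0" "1 / (exp 1 * K) > 0" "K' / 4 > 0" "2 * (exp 1 * K) > 0"
    using K K' by simp_all
  show ?thesis
    by (rule conjI, rule exI, rule conjI[OF pos(1)], rule exI, rule conjI[OF pos(2)], rule num,
        rule exI, rule conjI[OF pos(3)], rule exI, rule conjI[OF pos(4)], rule number[unfolded N_def])
qed

end
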